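(* Suppose $G$ is an approximately compact separable metrisable topological group with the local property (OB) admitting a uniformly continuous coarse embedding into a Banach space $E$ with type $p$ and cotype $q$ for some $1\leqslant p\leqslant 2\leqslant q\leqslant\infty$. Then $G$ admits a metrically proper affine isometric action on a Banach space with type $p$ and cotype $q$.
   Context: A topological group $G$ is approximately compact if there is a countable chain $K_0\leqslant K_1\leqslant\ldots\leqslant G$ of compact subgroups whose union is dense in $G$. A metric on $G$ is compatible if it induces the topology of $G$, and left-invariant if $d(hg,hf)=d(g,f)$ for all $g,f,h\in G$. A subset $A\subseteq G$ has property (OB) relative to $G$ if it has finite diameter with respect to every compatible left-invariant metric on $G$; $G$ has the local property (OB) if some neighbourhood of $1$ has property (OB) relative to $G$. A sequence $(g_n)$ in $G$ tends to infinity, written $g_n\to\infty$, if $\partial(g_n,1)\to\infty$ for some compatible left-invariant metric $\partial$ on $G$. A compatible left-invariant metric $d$ is metrically proper if $d(g_n,1)\to\infty$ whenever $g_n\to\infty$. A separable metrisable group with the local property (OB) admits a metrically proper compatible left-invariant metric $d$; "uniformly continuous coarse embedding" refers to any such $d$ (the notion does not depend on the choice). For a map $F\colon (X,d_X)\to(Y,d_Y)$ between metric spaces put $\kappa_1(t)=\inf\{d_Y(Fx_1,Fx_2): d_X(x_1,x_2)\geqslant t\}$ and $\kappa_2(t)=\sup\{d_Y(Fx_1,Fx_2): d_X(x_1,x_2)\leqslant t\}$. $F$ is a coarse embedding if $\lim_{t\to\infty}\kappa_1(t)=\infty$ and $\kappa_2(t)<\infty$ for all $t\in[0,\infty)$.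 Let $(\epsilon_n)$ be a sequence of independent random variables with $\mathbb{P}(\epsilon_n=1)=\mathbb{P}(\epsilon_n=-1)=\frac12$. A Banach space $X$ has type $p$ ($1\leqslant p\leqslant 2$) if there is a constant $C$ with $\big(\mathbb{E}\|\sum_{i=1}^n\epsilon_ix_i\|^p\big)^{1/p}\leqslant C\big(\sum_{i=1}^n\|x_i\|^p\big)^{1/p}$ for all finite sequences $x_1,\ldots,x_n\in X$; it has cotype $q$ ($2\leqslant q<\infty$) if there is a constant $K$ with $\big(\sum_{i=1}^n\|x_i\|^q\big)^{1/q}\leqslant K\big(\mathbb{E}\|\sum_{i=1}^n\epsilon_ix_i\|^q\big)^{1/q}$ for all such sequences. By stipulation every Banach space has cotype $\infty$. An affine isometric action of $G$ on a Banach space $X$ is an action $\alpha(g)\xi=\pi(g)\xi+b(g)$, where $\pi$ is a representation by invertible linear isometries of $X$ and $b(gf)=\pi(g)b(f)+b(g)$. It is metrically proper if for all $\xi\in X$, $\|\alpha(g_n)\xi-\xi\|\to\infty$ whenever $g_n\to\infty$. *)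

theory Defs
  imports "HOL-Analysis.Analysis" "HOL-Probability.Probability"
begin

text \<open>
  Topological groups are types of class \<^class>\<open>topological_group_add\<close>: the group operation is
  written additively, with neutral element \<open>0\<close>, but is not assumed to be commutative.
\<close>

definition subgroup_add :: "'g::group_add set \<Rightarrow> bool" where
  "subgroup_add H \<longleftrightarrow> 0 \<in> H \<and> (\<forall>x\<in>H. \<forall>y\<in>H. x + y \<in> H) \<and> (\<forall>x\<in>H. - x \<in> H)"

definition approximately_compact :: "'g::topological_group_add itself \<Rightarrow> bool" where
  "approximately_compact _ \<longleftrightarrow>
     (\<exists>K :: nat \<Rightarrow> 'g set.
        (\<forall>n. subgroup_add (K n) \<and> compact (K n) \<and> K n \<subseteq> K (Suc n)) \<and>
        closure (\<Union>n. K n) = UNIV)"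

definition compatible_left_invariant_metric :: "'g::topological_group_add metric \<Rightarrow> bool" where
  "compatible_left_invariant_metric d \<longleftrightarrow>
     mspace d = UNIV \<and> mtopology_of d = euclidean \<and>
     (\<forall>h g f. mdist d (h + g) (h + f) = mdist d g f)"

definition property_OB :: "'g::topological_group_add set \<Rightarrow> bool" where
  "property_OB A \<longleftrightarrow>
     (\<forall>d. compatible_left_invariant_metric d \<longrightarrow>
        (\<exists>B. \<forall>x\<in>A. \<forall>y\<in>A. mdist d x y \<le> B))"

definition local_property_OB :: "'g::topological_group_add itself \<Rightarrow> bool" where
  "local_property_OB _ \<longleftrightarrow> (\<exists>U :: 'g set. 0 \<in> interior U \<and> property_OB U)"

definition tends_to_infinity :: "(nat \<Rightarrow> 'g::topological_group_add) \<Rightarrow> bool" where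
  "tends_to_infinity g \<longleftrightarrow>
     (\<exists>d. compatible_left_invariant_metric d \<and>
        filterlim (\<lambda>n. mdist d (g n) 0) at_top sequentially)"

definition metrically_proper_metric :: "'g::topological_group_add metric \<Rightarrow> bool" where
  "metrically_proper_metric d \<longleftrightarrow>
     compatible_left_invariant_metric d \<and>
     (\<forall>g. tends_to_infinity g \<longrightarrow> filterlim (\<lambda>n. mdist d (g n) 0) at_top sequentially)"

text \<open>
  The moduli take values in \<^typ>\<open>ereal\<close>, so that an infimum over the empty set is \<open>\<infinity>\<close>
  and an unbounded supremum is \<open>\<infinity>\<close>.
\<close>

definition kappa1 :: "'a metric \<Rightarrow> 'b metric \<Rightarrow> ('a \<Rightarrow> 'b) \<Rightarrow> real \<Rightarrow> ereal" where
  "kappa1 dX dY F t =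
     Inf {ereal (mdist dY (F x) (F y)) | x y. x \<in> mspace dX \<and> y \<in> mspace dX \<and> mdist dX x y \<ge> t}"

definition kappa2 :: "'a metric \<Rightarrow> 'b metric \<Rightarrow> ('a \<Rightarrow> 'b) \<Rightarrow> real \<Rightarrow> ereal" where
  "kappa2 dX dY F t =
     Sup {ereal (mdist dY (F x) (F y)) | x y. x \<in> mspace dX \<and> y \<in> mspace dX \<and> mdist dX x y \<le> t}"

definition coarse_embedding :: "'a metric \<Rightarrow> 'b metric \<Rightarrow> ('a \<Rightarrow> 'b) \<Rightarrow> bool" where
  "coarse_embedding dX dY F \<longleftrightarrow>
     F \<in> mspace dX \<rightarrow> mspace dY \<and>
     (kappa1 dX dY F \<longlongrightarrow> \<infinity>) at_top \<and> (\<forall>t\<ge>0. kappa2 dX dY F t < \<infinity>)"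

text \<open>
  The law of \<open>n\<close> independent symmetric random signs.
\<close>

definition rademacher_pmf :: "nat \<Rightarrow> (nat \<Rightarrow> real) pmf" where
  "rademacher_pmf n = Pi_pmf {..<n} 0 (\<lambda>_. pmf_of_set {-1, 1})"

text \<open>
  Below, \<open>V\<close> is a linear subspace of a normed space, normed by restriction; the whole
  space is \<open>V = UNIV\<close>.
\<close>

definition has_type :: "'v::real_normed_vector set \<Rightarrow> real \<Rightarrow> bool" where
  "has_type V p \<longleftrightarrow>
     (\<exists>C. \<forall>n (x :: nat \<Rightarrow> 'v). (\<forall>i<n. x i \<in> V) \<longrightarrow>
        (measure_pmf.expectation (rademacher_pmf n)
           (\<lambda>\<epsilon>. norm (\<Sum>i<n. \<epsilon> i *\<^sub>R x i) powr p)) powr (1 / p)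
        \<le> C * (\<Sum>i<n. norm (x i) powr p) powr (1 / p))"

definition has_finite_cotype :: "'v::real_normed_vector set \<Rightarrow> real \<Rightarrow> bool" where
  "has_finite_cotype V q \<longleftrightarrow>
     (\<exists>K. \<forall>n (x :: nat \<Rightarrow> 'v). (\<forall>i<n. x i \<in> V) \<longrightarrow>
        (\<Sum>i<n. norm (x i) powr q) powr (1 / q)
        \<le> K * (measure_pmf.expectation (rademacher_pmf n)
                 (\<lambda>\<epsilon>. norm (\<Sum>i<n. \<epsilon> i *\<^sub>R x i) powr q)) powr (1 / q))"

definition has_cotype :: "'v::real_normed_vector set \<Rightarrow> ereal \<Rightarrow> bool" where
  "has_cotype V q \<longleftrightarrow> q = \<infinity> \<or> (\<exists>r. q = ereal r \<and> has_finite_cotype V r)"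

definition invertible_linear_isometry_on ::
    "'v::real_normed_vector set \<Rightarrow> ('v \<Rightarrow> 'v) \<Rightarrow> bool" where
  "invertible_linear_isometry_on V T \<longleftrightarrow>
     bij_betw T V V \<and>
     (\<forall>x\<in>V. \<forall>y\<in>V. T (x + y) = T x + T y) \<and>
     (\<forall>c. \<forall>x\<in>V. T (c *\<^sub>R x) = c *\<^sub>R T x) \<and>
     (\<forall>x\<in>V. norm (T x) = norm x)"

definition isometric_representation_on ::
    "'v::real_normed_vector set \<Rightarrow> ('g::group_add \<Rightarrow> 'v \<Rightarrow> 'v) \<Rightarrow> bool" where
  "isometric_representation_on V \<pi> \<longleftrightarrow>
     (\<forall>g. invertible_linear_isometry_on V (\<pi> g)) \<and>
     (\<forall>x\<in>V. \<pi> 0 x = x) \<and>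
     (\<forall>g h. \<forall>x\<in>V. \<pi> (g + h) x = \<pi> g (\<pi> h x))"

definition affine_isometric_action_on ::
    "'v::real_normed_vector set \<Rightarrow> ('g::group_add \<Rightarrow> 'v \<Rightarrow> 'v) \<Rightarrow> bool" where
  "affine_isometric_action_on V \<alpha> \<longleftrightarrow>
     (\<exists>\<pi> b. isometric_representation_on V \<pi> \<and>
        (\<forall>g. b g \<in> V) \<and> (\<forall>g f. b (g + f) = \<pi> g (b f) + b g) \<and>
        (\<forall>g. \<forall>\<xi>\<in>V. \<alpha> g \<xi> = \<pi> g \<xi> + b g))"

definition metrically_proper_action_on ::
    "'v::real_normed_vector set \<Rightarrow> ('g::topological_group_add \<Rightarrow> 'v \<Rightarrow> 'v) \<Rightarrow> bool" where
  "metrically_proper_action_on V \<alpha> \<longleftrightarrow>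
     (\<forall>\<xi>\<in>V. \<forall>g. tends_to_infinity g \<longrightarrow>
        filterlim (\<lambda>n. norm (\<alpha> (g n) \<xi> - \<xi>)) at_top sequentially)"

text \<open>
  \<^typ>\<open>nat \<Rightarrow>\<^sub>C real\<close> with the supremum norm is the Banach space of bounded real sequences.
  HOL cannot quantify existentially over types, so existence of a Banach space is expressed by
  existence of a closed linear subspace of this space; up to linear isometry these include all
  separable Banach spaces. A continuous affine isometric action of a separable group restricts
  to the closed linear span of its cocycle, which is separable and inherits type, cotype and
  metric properness, so the actions of interest are all captured.
\<close>

type_synonym linfty = "nat \<Rightarrow>\<^sub>C real"

end

theory Submission
  imports Defs
begin

text \<open>
  For \<open>g\<close> in \<open>G\<close> let \<open>b g\<close> be the bounded function \<open>x \<mapsto> \<phi> (x + g) - \<phi> x\<close>; then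
  \<open>b (g + f) = translate g (b f) + b g\<close>. On bounded functions consider the \<open>L\<^sup>p\<close>
  seminorms for the uniform measure on a net \<open>A\<close> of minimal cardinality in a compact subgroup
  \<open>K n\<close>. As \<open>n\<close> grows and the nets get finer, a limit of these seminorms is translation
  invariant on uniformly continuous functions, and translation becomes an isometric representation
  with cocycle \<open>b\<close>. Left invariance of \<open>d\<close> gives \<open>d (x + g) x = d g 0\<close> for all \<open>x\<close>, so the lower
  modulus of \<open>\<phi>\<close> bounds the seminorm of \<open>b g\<close> from below.

  Type \<open>p\<close> passes to such seminorms by averaging the type inequality of \<open>E\<close> over \<open>A\<close>. For cotype
  \<open>q\<close> one uses Minkowski's inequality in \<open>\<ell>\<^sup>q\<^sup>/\<^sup>p\<close> and Kahane's inequality, which is derived from a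
  vector-valued two-point hypercontractive estimate. Support functionals at a dense sequence
  embed the separable quotient isometrically into \<^typ>\<open>linfty\<close>.
\<close>

section \<open>Almost invariant finite subsets of compact groups\<close>

text \<open>Only differences of \<open>\<phi>\<close> are bounded, through the upper modulus at
  \<open>mdist d g 0\<close>; this is why the averages are taken of \<open>b g\<close> and its
  translates and never of \<open>\<phi>\<close> itself. Uniform continuity enters twice. Matching a
  net with its translate moves each point by less than \<delta>, which costs the oscillation of a
  function at that scale. And an arbitrary g is replaced by a nearby element of some
  \<open>K m\<close>, which changes the translated function little in supremum norm. The exponent of
  the average is that of the type inequality, so this inequality integrates without loss. For cotype
  the exponents p of the average and q of the inequality differ. Since p \<le> 2 \<le> q,
  Minkowski's inequality for q / p puts the sum over i inside the average, and comparing the q-th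
  and p-th moments of random sums is the price. The limit is recorded as a number \<open>M F\<close>
  for each function F and not as an ultraproduct. Every inequality that has to survive involves
  finitely many functions and is closed, so it passes to these numbers.\<close>

lemma sum_le_sum_levels:
  fixes u :: "'a \<Rightarrow> real" and v :: "'b \<Rightarrow> real"
  assumes "finite A" "finite B" "card A = card B"
    and "\<And>t. card {a\<in>A. t \<le> u a} \<le> card {b\<in>B. t \<le> v b}"
  shows "sum u A \<le> sum v B"
  using assms
proof (induction "card A" arbitrary: A B)
  case 0
  then show ?case by simp
next
  case (Suc n)
  from Suc.hyps(2) have neA: "A \<noteq> {}" by auto
  from Suc.hyps(2) Suc.prems(3) have neB: "B \<noteq> {}" by auto
  have "Max (u ` A) \<in> u ` A" using Suc.prems(1) neA by simp
  then obtain a where "a \<in> A" "u a = Max (u ` A)" by auto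
  then have a: "a \<in> A" "\<And>x. x \<in> A \<Longrightarrow> u x \<le> u a"
    using Suc.prems(1) by simp_all
  have "Max (v ` B) \<in> v ` B" using Suc.prems(2) neB by simp
  then obtain b where "b \<in> B" "v b = Max (v ` B)" by auto
  then have b: "b \<in> B" "\<And>x. x \<in> B \<Longrightarrow> v x \<le> v b"
    using Suc.prems(2) by simp_all
  have "0 < card {x\<in>A. u a \<le> u x}"
    using a(1) Suc.prems(1) by (auto simp: card_gt_0_iff)
  with Suc.prems(4)[of "u a"] have "0 < card {x\<in>B. u a \<le> v x}" by linarith
  then obtain c where "c \<in> B" "u a \<le> v c"
    by (metis (mono_tags, lifting) card_gt_0_iff empty_Collect_eq)
  with b(2) have uv: "u a \<le> v b" by (meson order_trans)
  \<comment> \<open>Deleting both maxima preserves the count hypothesis: for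
    \<open>t \<le> u a\<close> each side loses exactly one element, and for larger \<open>t\<close>
    nothing is left on the side of \<open>A\<close>. Values are thus matched from the top, and no
    bijection has to be built.\<close>
  have "sum u (A - {a}) \<le> sum v (B - {b})"
  proof (rule Suc.hyps(1))
    show "card {x \<in> A - {a}. t \<le> u x} \<le> card {x \<in> B - {b}. t \<le> v x}" for t
    proof (cases "t \<le> u a")
      case True
      have "{x \<in> A - {a}. t \<le> u x} = {x \<in> A. t \<le> u x} - {a}"
        "{x \<in> B - {b}. t \<le> v x} = {x \<in> B. t \<le> v x} - {b}" by auto
      moreover have "a \<in> {x \<in> A. t \<le> u x}" "b \<in> {x \<in> B. t \<le> v x}"
        using a(1) b(1) True uv by auto
      ultimately show ?thesis
        using Suc.prems(4)[of t] by (simp add: diff_le_mono)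
    next
      case False
      then have "{x \<in> A - {a}. t \<le> u x} = {}" using a(2) by force
      then show ?thesis by (simp only: card.empty le0)
    qed
  qed (use Suc a(1) b(1) in \<open>auto simp: card_Diff_singleton\<close>)
  with uv show ?case
    using sum.remove[OF Suc.prems(1) a(1), of u] sum.remove[OF Suc.prems(2) b(1), of v] by linarith
qed

lemma left_invariant_mdist_eq:
  assumes "compatible_left_invariant_metric d"
  shows "mdist d x y = mdist d 0 (- x + y)"
proof -
  have "mdist d (- x + x) (- x + y) = mdist d x y"
    using assms unfolding compatible_left_invariant_metric_def by blast
  then show ?thesis by simp
qed

lemma compatible_metric_open_ball:
  assumes "compatible_left_invariant_metric d"
  shows "open {y. mdist d x y < e}"
proof -
  interpret Metric_space "mspace d" "mdist d" by (rule Metric_space_mspace_mdist)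
  have sp: "mspace d = UNIV" and top: "mtopology_of d = euclidean"
    using assms(1) unfolding compatible_left_invariant_metric_def by blast+
  have "openin (mtopology_of d) (mball x e)"
    by (simp add: mtopology_of_def)
  moreover have "y \<in> mball x e \<longleftrightarrow> mdist d x y < e" for y
    using in_mball[of y x e] by (simp add: sp)
  then have "mball x e = {y. mdist d x y < e}" by blast
  ultimately show ?thesis
    by (simp only: open_openin top)
qed

lemma compatible_metric_ball_subset:
  assumes "compatible_left_invariant_metric d" "open U" "x \<in> U"
  obtains e where "0 < e" "\<And>y. mdist d x y < e \<Longrightarrow> y \<in> U"
proof -
  interpret Metric_space "mspace d" "mdist d" by (rule Metric_space_mspace_mdist)
  have sp: "mspace d = UNIV" and top: "mtopology_of d = euclidean"
    using assms(1) unfolding compatible_left_invariant_metric_def by blast+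
  have "openin (mtopology_of d) U"
    using assms(2) by (simp only: open_openin top)
  then obtain r where "r > 0" "mball x r \<subseteq> U"
    using assms(3) by (auto simp: mtopology_of_def openin_mtopology)
  moreover have "y \<in> mball x r \<longleftrightarrow> mdist d x y < r" for y
    using in_mball[of y x r] by (simp add: sp)
  then have "mball x r = {y. mdist d x y < r}" by blast
  ultimately show thesis using that by blast
qed

text \<open>Left invariance ties \<open>mdist d x y\<close> to \<open>- x + y\<close>, whereas
  \<open>x - y \<in> W\<close> is the relation preserved by right translation. The two differences
  are linked by inversion and conjugation by \<open>x\<close>; for \<open>x\<close> in a compact set
  the tube lemma controls this conjugation uniformly near 0.\<close>

lemma compact_right_uniformity:
  fixes K :: "'g::topological_group_add set"
  assumes d: "compatible_left_invariant_metric d" and "compact K" "0 < e"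
  obtains W where "open W" "0 \<in> W" "\<And>x y. x \<in> K \<Longrightarrow> x - y \<in> W \<Longrightarrow> mdist d x y < e"
proof -
  define V where "V = {z :: 'g \<times> 'g. mdist d 0 (- snd z - fst z + snd z) < e}"
  have cont: "continuous_on UNIV (\<lambda>z :: 'g \<times> 'g. - snd z - fst z + snd z)"
    unfolding diff_conv_add_uminus continuous_on_def
    by (intro ballI tendsto_intros)
  have "open V"
    using open_vimage[OF compatible_metric_open_ball[OF d, of 0 e] cont]
    by (simp add: V_def vimage_def)
  moreover have "{0} \<times> K \<subseteq> V"
    using mdist_zero[of 0 d 0] d \<open>0 < e\<close>
    by (auto simp del: mdist_zero simp: V_def compatible_left_invariant_metric_def)
  ultimately obtain W where W: "0 \<in> W" "open W" "W \<times> K \<subseteq> V"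
    using Elementary_Topology.tube_lemma[OF \<open>compact K\<close>] by metis
  have "mdist d x y < e" if "x \<in> K" "x - y \<in> W" for x y
  proof -
    have "(x - y, x) \<in> V" using W that by auto
    then have "mdist d 0 (- x - (x - y) + x) < e" by (simp add: V_def)
    moreover have "- x - (x - y) + x = - x + y"
      by (simp add: diff_conv_add_uminus minus_add add.assoc del: add_uminus_conv_diff minus_diff_eq)
    ultimately show ?thesis unfolding left_invariant_mdist_eq[OF d, of x y] by (simp only:)
  qed
  with W that show thesis by metis
qed

text \<open>
  A net of minimal cardinality replaces Haar measure: a translate of such a net is again one, so
  minimality forces Hall's condition between the two nets.
\<close>

lemma compact_subgroup_almost_invariant_finite_set:
  fixes K :: "'g::topological_group_add set"
  assumes d: "compatible_left_invariant_metric d"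
    and K: "subgroup_add K" "compact K" and "0 < \<delta>"
  obtains A where "finite A" "A \<noteq> {}" "A \<subseteq> K"
    "\<And>k F e. k \<in> K \<Longrightarrow> (\<And>x y. mdist d x y < \<delta> \<Longrightarrow> F x \<le> F y + e) \<Longrightarrow>
      (\<Sum>a\<in>A. F (a + k)) \<le> (\<Sum>a\<in>A. F a) + real (card A) * e"
proof -
  obtain W where W: "open W" "0 \<in> W" "\<And>x y. x \<in> K \<Longrightarrow> x - y \<in> W \<Longrightarrow> mdist d x y < \<delta>"
    using compact_right_uniformity[OF d K(2) \<open>0 < \<delta>\<close>] by blast
  have "((\<lambda>z :: 'g \<times> 'g. - fst z + snd z) \<longlongrightarrow> - 0 + 0) (nhds (0, 0))"
    by (intro tendsto_intros tendsto_fst[where a = "(0, 0)", simplified]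
        tendsto_snd[where a = "(0, 0)", simplified] filterlim_ident)
  then have "eventually (\<lambda>z. - fst z + snd z \<in> W) (nhds (0 :: 'g, 0 :: 'g))"
    using W by (auto simp: tendsto_def)
  then obtain Z where Z: "open Z" "(0, 0) \<in> Z" "\<And>z. z \<in> Z \<Longrightarrow> - fst z + snd z \<in> W"
    by (auto simp: eventually_nhds)
  obtain U1 U2 where "open U1" "open U2" "0 \<in> U1" "0 \<in> U2" "U1 \<times> U2 \<subseteq> Z"
    using open_prod_elim[OF Z(1,2)] by (metis mem_Sigma_iff)
  then have U12: "\<And>u v. u \<in> U1 \<inter> U2 \<Longrightarrow> v \<in> U1 \<inter> U2 \<Longrightarrow> - u + v \<in> W"
    using Z(3) by fastforce
  define U where "U = U1 \<inter> U2"
  have U: "open U" "0 \<in> U" using \<open>open U1\<close> \<open>open U2\<close> \<open>0 \<in> U1\<close> \<open>0 \<in> U2\<close> by (auto simp: U_def)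
  \<comment> \<open>Since \<open>(x + k) - (a + k) = x - a\<close>, right translation by an element
    of \<open>K\<close> carries nets to nets of the same cardinality.\<close>
  define net where "net A \<longleftrightarrow> finite A \<and> A \<subseteq> K \<and> (\<forall>x\<in>K. \<exists>a\<in>A. x - a \<in> U)" for A
  have "open {x. x - a \<in> U}" for a
  proof -
    have "continuous_on UNIV (\<lambda>x. x - a)"
      unfolding diff_conv_add_uminus continuous_on_def by (intro ballI tendsto_intros)
    from open_vimage[OF U(1) this] show ?thesis by (simp add: vimage_def)
  qed
  moreover have "K \<subseteq> (\<Union>a\<in>K. {x. x - a \<in> U})" using U(2) by auto
  ultimately obtain A0 where "A0 \<subseteq> K" "finite A0" "K \<subseteq> (\<Union>a\<in>A0. {x. x - a \<in> U})"
    using compactE_image[OF K(2)] by metis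
  then have "net A0" by (force simp: net_def)
  then obtain A where A: "net A" "\<And>B. net B \<Longrightarrow> card A \<le> card B"
    using ex_has_least_nat[of net A0 card] by blast
  then have fin: "finite A" and sub: "A \<subseteq> K" by (auto simp: net_def)
  have ne: "A \<noteq> {}" using A(1) K(1) by (auto simp: net_def subgroup_add_def)
  have "(\<Sum>a\<in>A. F (a + k)) \<le> (\<Sum>a\<in>A. F a) + real (card A) * e"
    if k: "k \<in> K" and F: "\<And>x y. mdist d x y < \<delta> \<Longrightarrow> F x \<le> F y + e" for k F e
  proof -
    have "(\<Sum>a\<in>A. F (a + k)) \<le> (\<Sum>a\<in>A. F a + e)"
    proof (rule sum_le_sum_levels)
      fix t
      define S where "S = {a\<in>A. t \<le> F (a + k)}"
      \<comment> \<open>Call the points x with \<open>x - a \<in> U\<close> the cell of a.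
        \<open>J\<close> consists of the points of \<open>A\<close> whose cell meets, inside
        \<open>K\<close>, the cell of a point of \<open>S + k\<close>. In the translated net
        \<open>A + k\<close> the points of \<open>S + k\<close> may be traded for \<open>J\<close>:
        whatever they cover is also covered by some point of \<open>A\<close>, which then lies in
        \<open>J\<close>. Minimality yields \<open>card S \<le> card J\<close>.\<close>
      define J where "J = {b\<in>A. \<exists>s\<in>S. \<exists>x\<in>K. x - (s + k) \<in> U \<and> x - b \<in> U}"
      define B where "B = (\<lambda>a. a + k) ` (A - S) \<union> J"
      have SA: "S \<subseteq> A" "J \<subseteq> A" by (auto simp: S_def J_def)
      have "net B"
        unfolding net_def
      proof (intro conjI ballI)
        show "finite B" using fin SA by (auto simp: B_def intro: finite_subset)
        show "B \<subseteq> K" using sub SA k K(1) by (auto simp: B_def subgroup_add_def)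
        fix x assume x: "x \<in> K"
        have "x - k \<in> K"
          using x k K(1) unfolding subgroup_add_def diff_conv_add_uminus by blast
        then obtain a where a: "a \<in> A" "x - k - a \<in> U" using A(1) by (auto simp: net_def)
        obtain b where b: "b \<in> A" "x - b \<in> U" using x A(1) by (auto simp: net_def)
        have eq: "x - (a + k) = x - k - a"
          by (simp add: add.assoc diff_conv_add_uminus minus_add del: add_uminus_conv_diff)
        then have xU: "x - (a + k) \<in> U" using a(2) by simp
        show "\<exists>a\<in>B. x - a \<in> U"
        proof (cases "a \<in> S")
          case True
          then have "b \<in> J" unfolding J_def using b x xU by blast
          then show ?thesis using b(2) unfolding B_def by blast
        next
          case False
          then show ?thesis using a(1) xU unfolding B_def by blast
        qed
      qed
      then have "card A \<le> card B" by (rule A(2))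
      also have "card B \<le> card (A - S) + card J"
        unfolding B_def using fin SA
        by (meson card_Un_le card_image_le finite_Diff add_le_mono1 order_trans)
      also have "card (A - S) = card A - card S"
        using SA fin by (simp add: card_Diff_subset finite_subset)
      finally have "card S \<le> card J"
        using card_mono[OF fin SA(1)] by linarith
      also have "J \<subseteq> {b\<in>A. t \<le> F b + e}"
      proof
        fix b assume "b \<in> J"
        then obtain s x where *: "b \<in> A" "s \<in> S" "x \<in> K" "x - (s + k) \<in> U" "x - b \<in> U"
          by (auto simp: J_def)
        \<comment> \<open>The common point \<open>x\<close> cancels, so \<open>s + k\<close> and
          \<open>b\<close> are closer than \<delta> and \<open>F b\<close> falls short of the level
          \<open>t\<close> by at most \<open>e\<close>.\<close>
        have "- (x - (s + k)) + (x - b) \<in> W" using *(4,5) U12 unfolding U_def by blast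
        moreover have "- (x - (s + k)) + (x - b) = (s + k) - b"
          by (simp add: add.assoc diff_conv_add_uminus minus_add del: add_uminus_conv_diff)
        moreover have "s + k \<in> K" using * SA sub k K(1) by (auto simp: subgroup_add_def)
        ultimately have "mdist d (s + k) b < \<delta>" using W(3) by metis
        then have "F (s + k) \<le> F b + e" by (rule F)
        then show "b \<in> {b\<in>A. t \<le> F b + e}" using * by (auto simp: S_def)
      qed
      then have "card J \<le> card {b\<in>A. t \<le> F b + e}" using fin by (intro card_mono) auto
      finally show "card {a\<in>A. t \<le> F (a + k)} \<le> card {b\<in>A. t \<le> F b + e}"
        by (simp add: S_def)
    qed (use fin in auto)
    then show ?thesis by (simp add: sum.distrib)
  qed
  with that fin ne sub show thesis by metis
qed

section \<open>Averages and random signs\<close>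

text \<open>One operator serves both as the mean over a net and as the expectation over random
  signs, so Fubini is an interchange of finite sums.\<close>

definition avg :: "'a set \<Rightarrow> ('a \<Rightarrow> real) \<Rightarrow> real" where
  "avg A f = (\<Sum>a\<in>A. f a) / real (card A)"

lemma avg_mono: "(\<And>a. a \<in> A \<Longrightarrow> f a \<le> g a) \<Longrightarrow> avg A f \<le> avg A g"
  by (simp add: avg_def divide_right_mono sum_mono)

lemma avg_nonneg: "(\<And>a. a \<in> A \<Longrightarrow> 0 \<le> f a) \<Longrightarrow> 0 \<le> avg A f"
  by (simp add: avg_def sum_nonneg)

lemma avg_add: "avg A (\<lambda>a. f a + g a) = avg A f + avg A g"
  by (simp add: avg_def sum.distrib add_divide_distrib)

lemma avg_cmult: "avg A (\<lambda>a. c * f a) = c * avg A f"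
  by (simp add: avg_def sum_distrib_left)

lemma avg_const: "finite A \<Longrightarrow> A \<noteq> {} \<Longrightarrow> avg A (\<lambda>_. c) = c"
  by (simp add: avg_def)

lemma avg_sum: "avg A (\<lambda>a. \<Sum>i\<in>I. f i a) = (\<Sum>i\<in>I. avg A (f i))"
  by (simp add: avg_def sum.swap[of _ I] sum_divide_distrib)

lemma avg_swap: "avg A (\<lambda>a. avg B (\<lambda>b. f a b)) = avg B (\<lambda>b. avg A (\<lambda>a. f a b))"
  by (simp add: avg_def sum.swap[of _ A] mult.commute flip: sum_divide_distrib)

lemma powr_convex_nonneg:
  assumes "1 \<le> (p::real)"
  shows "convex_on {0..} (\<lambda>x. x powr p)"
proof (rule convex_onI)
  fix t x y :: real
  assume t: "0 < t" "t < 1" and xy: "x \<in> {0..}" "y \<in> {0..}"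
  \<comment> \<open>Covers the boundary point 0, where convexity reduces to
    \<open>c powr p \<le> c\<close> for \<open>c\<close> in the unit interval; norms do vanish in
    the applications.\<close>
  have scale: "(c * z) powr p \<le> c * z powr p" if "0 < c" "c < 1" for c z
  proof -
    have "c powr p \<le> c powr 1" using that assms by (intro powr_mono') auto
    then show ?thesis using that by (simp add: powr_mult mult_right_mono)
  qed
  show "((1 - t) *\<^sub>R x + t *\<^sub>R y) powr p \<le> (1 - t) * x powr p + t * y powr p"
  proof (cases "x = 0 \<or> y = 0")
    case True
    then show ?thesis using scale[of t y] scale[of "1 - t" x] t by auto
  next
    case False
    then show ?thesis
      using convex_onD[OF powr_convex[OF assms], of t x y] t xy by auto
  qed
qed (rule convex_real_interval)

lemma avg_powr_le:
  assumes "finite A" "A \<noteq> {}" "\<And>a. a \<in> A \<Longrightarrow> 0 \<le> f a" "1 \<le> s"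
  shows "avg A f powr s \<le> avg A (\<lambda>a. f a powr s)"
proof -
  have "(\<Sum>a\<in>A. (1 / card A) *\<^sub>R f a) powr s \<le> (\<Sum>a\<in>A. 1 / card A * f a powr s)"
    by (rule convex_on_sum[OF assms(1,2) powr_convex_nonneg[OF assms(4)]]) (use assms in auto)
  then show ?thesis by (simp add: avg_def sum_divide_distrib)
qed

text \<open>The vectors \<open>(g i a)\<close> indexed by \<open>i\<close> are summed over
  \<open>a\<close>. Divide each by a bound \<open>h a\<close> of its s-norm and weight it with
  \<open>h a / H\<close>: the sum becomes H times a convex combination of vectors of s-norm at most
  1, and convexity of the s-th power bounds the combination by 1.\<close>

lemma avg_Minkowski:
  assumes "finite A" "A \<noteq> {}" "finite I" "1 \<le> s"
    and g: "\<And>i a. i \<in> I \<Longrightarrow> a \<in> A \<Longrightarrow> 0 \<le> g i a"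
  shows "(\<Sum>i\<in>I. avg A (g i) powr s) powr (1 / s)
    \<le> avg A (\<lambda>a. (\<Sum>i\<in>I. g i a powr s) powr (1 / s))"
proof (rule field_le_epsilon)
  fix e :: real assume "0 < e"
  \<comment> \<open>The summand \<open>e\<close> keeps \<open>h\<close> positive where all
    \<open>g i a\<close> vanish, so that division is harmless.\<close>
  define h where "h a = (\<Sum>i\<in>I. g i a powr s) powr (1 / s) + e" for a
  define H where "H = (\<Sum>a\<in>A. h a)"
  have h: "0 < h a" for a using \<open>0 < e\<close> by (simp add: h_def add_nonneg_pos)
  have H: "0 < H" unfolding H_def using assms(1,2) h by (simp add: sum_pos)
  have hs: "(\<Sum>i\<in>I. g i a powr s) \<le> h a powr s" for a
  proof -
    have "(\<Sum>i\<in>I. g i a powr s) = ((\<Sum>i\<in>I. g i a powr s) powr (1 / s)) powr s"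
      using assms(4) by (simp add: powr_powr sum_nonneg)
    also have "\<dots> \<le> h a powr s"
      using \<open>0 < e\<close> assms(4) by (intro powr_mono2) (auto simp: h_def)
    finally show ?thesis .
  qed
  have "(\<Sum>i\<in>I. (\<Sum>a\<in>A. g i a) powr s) / H powr s = (\<Sum>i\<in>I. (\<Sum>a\<in>A. g i a / H) powr s)"
    unfolding sum_divide_distrib
    using H g by (intro sum.cong refl) (simp add: powr_divide sum_nonneg flip: sum_divide_distrib)
  also have "\<dots> \<le> (\<Sum>i\<in>I. \<Sum>a\<in>A. h a / H * (g i a / h a) powr s)"
  proof (rule sum_mono)
    fix i assume i: "i \<in> I"
    have "(\<Sum>a\<in>A. (h a / H) *\<^sub>R (g i a / h a)) powr s \<le> (\<Sum>a\<in>A. h a / H * (g i a / h a) powr s)"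
    proof (rule convex_on_sum[OF assms(1,2) powr_convex_nonneg[OF assms(4)]])
      show "(\<Sum>a\<in>A. h a / H) = 1" using H by (simp add: H_def flip: sum_divide_distrib)
    qed (use h H g i in \<open>auto simp: less_imp_le\<close>)
    moreover have "(h a / H) *\<^sub>R (g i a / h a) = g i a / H" for a
      using h[of a] by simp
    ultimately show "(\<Sum>a\<in>A. g i a / H) powr s \<le> (\<Sum>a\<in>A. h a / H * (g i a / h a) powr s)" by simp
  qed
  also have "\<dots> = (\<Sum>a\<in>A. h a / H * ((\<Sum>i\<in>I. g i a powr s) / h a powr s))"
    unfolding sum.swap[of _ A I] sum_distrib_left sum_divide_distrib
    using h g by (intro sum.cong refl) (simp add: powr_divide less_imp_le)
  also have "\<dots> \<le> (\<Sum>a\<in>A. h a / H * 1)"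
  proof (intro sum_mono mult_left_mono)
    show "(\<Sum>i\<in>I. g i a powr s) / h a powr s \<le> 1" for a
      using h[of a] hs[of a] by (simp add: divide_le_eq_1)
  qed (use h H in \<open>simp add: less_imp_le\<close>)
  also have "\<dots> = 1" using H by (simp add: H_def flip: sum_divide_distrib)
  finally have "(\<Sum>i\<in>I. (\<Sum>a\<in>A. g i a) powr s) \<le> H powr s"
    using H by (simp add: divide_le_eq)
  then have "(\<Sum>i\<in>I. (\<Sum>a\<in>A. g i a) powr s) / card A powr s \<le> H powr s / card A powr s"
    by (rule divide_right_mono) simp
  moreover have "(\<Sum>a\<in>A. g i a) powr s / card A powr s = avg A (g i) powr s" if "i \<in> I" for i
    using g[OF that] by (simp add: avg_def powr_divide sum_nonneg)
  ultimately have "(\<Sum>i\<in>I. avg A (g i) powr s) \<le> (H / card A) powr s"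
    using H by (simp add: powr_divide sum_divide_distrib)
  then have "(\<Sum>i\<in>I. avg A (g i) powr s) powr (1 / s) \<le> ((H / card A) powr s) powr (1 / s)"
    using assms(4) by (intro powr_mono2) (auto simp: sum_nonneg)
  also have "\<dots> = avg A h" using H assms(4) by (simp add: powr_powr H_def avg_def)
  also have "\<dots> = avg A (\<lambda>a. (\<Sum>i\<in>I. g i a powr s) powr (1 / s)) + e"
    unfolding h_def using assms(1,2) by (simp add: avg_add avg_const)
  finally show "(\<Sum>i\<in>I. avg A (g i) powr s) powr (1 / s)
    \<le> avg A (\<lambda>a. (\<Sum>i\<in>I. g i a powr s) powr (1 / s)) + e" .
qed

section \<open>Random signs and hypercontractivity\<close>

definition signs :: "nat \<Rightarrow> (nat \<Rightarrow> real) set" where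
  "signs n = PiE_dflt {..<n} 0 (\<lambda>_. {-1, 1})"

lemma finite_signs: "finite (signs n)" and signs_nonempty: "signs n \<noteq> {}"
  by (auto simp: signs_def)

lemma expectation_rademacher_pmf:
  "measure_pmf.expectation (rademacher_pmf n) f = avg (signs n) f"
proof -
  have "rademacher_pmf n = pmf_of_set (signs n)"
    unfolding rademacher_pmf_def signs_def by (rule Pi_pmf_of_set) auto
  then show ?thesis
    by (simp add: integral_pmf_of_set finite_signs signs_nonempty avg_def)
qed

lemma avg_signs_Suc:
  "avg (signs (Suc n)) f
    = (avg (signs n) (\<lambda>\<epsilon>. f (\<epsilon>(n := 1))) + avg (signs n) (\<lambda>\<epsilon>. f (\<epsilon>(n := -1)))) / 2"
proof -
  \<comment> \<open>Coordinates outside \<open>{..<n}\<close> carry the default value 0; overwriting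
    coordinate \<open>n\<close> therefore forgets nothing, and both overwriting maps are
    injective.\<close>
  have zero: "\<epsilon> n = 0" if "\<epsilon> \<in> signs n" for \<epsilon>
    using that by (auto simp: signs_def PiE_dflt_def)
  have eq: "signs (Suc n) = (\<lambda>\<epsilon>. \<epsilon>(n := 1)) ` signs n \<union> (\<lambda>\<epsilon>. \<epsilon>(n := -1)) ` signs n"
  proof (intro equalityI subsetI)
    fix \<epsilon> assume \<epsilon>: "\<epsilon> \<in> signs (Suc n)"
    then have *: "\<epsilon>(n := 0) \<in> signs n" and n: "\<epsilon> n = 1 \<or> \<epsilon> n = -1"
      by (auto simp: signs_def PiE_dflt_def)
    have "\<epsilon> \<in> (\<lambda>\<delta>. \<delta>(n := \<epsilon> n)) ` signs n"
      by (rule image_eqI[OF _ *]) simp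
    with n show "\<epsilon> \<in> (\<lambda>\<epsilon>. \<epsilon>(n := 1)) ` signs n \<union> (\<lambda>\<epsilon>. \<epsilon>(n := -1)) ` signs n"
      by auto
  qed (auto simp: signs_def PiE_dflt_def less_Suc_eq)
  have disj: "(\<lambda>\<epsilon>. \<epsilon>(n := 1)) ` signs n \<inter> (\<lambda>\<epsilon>. \<epsilon>(n := -1)) ` signs n = {}"
  proof -
    have "\<epsilon> n = 1" if "\<epsilon> \<in> (\<lambda>\<epsilon>. \<epsilon>(n := 1)) ` signs n" for \<epsilon>
      using that by auto
    moreover have "\<epsilon> n = -1" if "\<epsilon> \<in> (\<lambda>\<epsilon>. \<epsilon>(n := -1)) ` signs n" for \<epsilon>
      using that by auto
    ultimately show ?thesis by fastforce
  qed
  have inj: "inj_on (\<lambda>\<epsilon>. \<epsilon>(n := c)) (signs n)" for c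
  proof (rule inj_onI)
    fix \<epsilon> \<delta> assume *: "\<epsilon> \<in> signs n" "\<delta> \<in> signs n" "\<epsilon>(n := c) = \<delta>(n := c)"
    have "\<epsilon> i = \<delta> i" for i
      using fun_cong[OF *(3), of i] zero[OF *(1)] zero[OF *(2)] by (cases "i = n") auto
    then show "\<epsilon> = \<delta>" by (rule ext)
  qed
  have "card (signs (Suc n)) = 2 * card (signs n)"
    unfolding eq using disj inj by (simp add: card_Un_disjoint finite_signs card_image)
  moreover have "sum f (signs (Suc n))
      = (\<Sum>\<epsilon>\<in>signs n. f (\<epsilon>(n := 1))) + (\<Sum>\<epsilon>\<in>signs n. f (\<epsilon>(n := -1)))"
    unfolding eq using disj inj by (simp add: sum.union_disjoint finite_signs sum.reindex)
  ultimately show ?thesis by (simp add: avg_def add_divide_distrib)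
qed

text \<open>Odd powers of \<open>b\<close> cancel, and the rest is compared term by term with the
  binomial expansion on the right. The constant is chosen for this comparison:
  \<open>2 * m choose (2 * j)\<close> is at most the (2j)-th power of 2m, which \<rho> cancels,
  leaving 1, and \<open>m choose j\<close> is at least 1. The sharp value, the inverse square root
  of 2m - 1, would not change the later argument.\<close>

lemma two_point_hypercontractive:
  fixes a b :: real
  assumes "0 < m" defines "\<rho> \<equiv> 1 / real (2 * m)"
  shows "((a + \<rho> * b) ^ (2 * m) + (a - \<rho> * b) ^ (2 * m)) / 2 \<le> (a\<^sup>2 + b\<^sup>2) ^ m"
proof -
  have "((a + \<rho> * b) ^ (2 * m) + (a - \<rho> * b) ^ (2 * m)) / 2
      = (\<Sum>k\<le>2 * m. real (2 * m choose k) * (((\<rho> * b) ^ k + (- (\<rho> * b)) ^ k) / 2) * a ^ (2 * m - k))"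
    using binomial_ring[of "\<rho> * b" a "2 * m"] binomial_ring[of "- (\<rho> * b)" a "2 * m"]
    by (simp add: algebra_simps sum.distrib add_divide_distrib sum_divide_distrib)
  also have "\<dots> = (\<Sum>k\<in>(\<lambda>j. 2 * j) ` {..m}. real (2 * m choose k) * (\<rho> * b) ^ k * a ^ (2 * m - k))"
  proof (rule sum.mono_neutral_cong_right)
    show "\<forall>k\<in>{..2 * m} - (\<lambda>j. 2 * j) ` {..m}.
        real (2 * m choose k) * (((\<rho> * b) ^ k + (- (\<rho> * b)) ^ k) / 2) * a ^ (2 * m - k) = 0"
    proof
      fix k assume k: "k \<in> {..2 * m} - (\<lambda>j. 2 * j) ` {..m}"
      have "odd k"
      proof
        assume "even k"
        then obtain j where "k = 2 * j" by blast
        with k show False by auto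
      qed
      then show "real (2 * m choose k) * (((\<rho> * b) ^ k + (- (\<rho> * b)) ^ k) / 2) * a ^ (2 * m - k) = 0"
        by simp
    qed
  qed auto
  also have "\<dots> = (\<Sum>j\<le>m. real (2 * m choose (2 * j)) * (\<rho> * b) ^ (2 * j) * a ^ (2 * m - 2 * j))"
    by (subst sum.reindex) (auto simp: inj_on_def)
  also have "\<dots> \<le> (\<Sum>j\<le>m. real (m choose j) * (b\<^sup>2) ^ j * (a\<^sup>2) ^ (m - j))"
  proof (rule sum_mono)
    fix j assume j: "j \<in> {..m}"
    have "real (2 * m choose (2 * j)) * \<rho> ^ (2 * j) \<le> 1"
    proof -
      have "real (2 * m choose (2 * j)) \<le> real (2 * m) ^ (2 * j)"
        using binomial_le_pow[of "2 * j" "2 * m"] j by (metis atMost_iff mult_le_mono2 of_nat_le_iff of_nat_power)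
      then show ?thesis using assms(1) by (simp add: \<rho>_def power_divide divide_le_eq)
    qed
    also have "1 \<le> real (m choose j)" using j by (simp add: Suc_leI)
    finally have "real (2 * m choose (2 * j)) * \<rho> ^ (2 * j) * (b ^ (2 * j) * a ^ (2 * (m - j)))
        \<le> real (m choose j) * (b ^ (2 * j) * a ^ (2 * (m - j)))"
      by (rule mult_right_mono) (simp add: power_mult)
    moreover have "a ^ (2 * m - 2 * j) = a ^ (2 * (m - j))" by (simp add: right_diff_distrib')
    ultimately show "real (2 * m choose (2 * j)) * (\<rho> * b) ^ (2 * j) * a ^ (2 * m - 2 * j)
        \<le> real (m choose j) * (b\<^sup>2) ^ j * (a\<^sup>2) ^ (m - j)"
      by (simp add: power_mult_distrib power_mult mult.assoc)
  qed
  also have "\<dots> = (a\<^sup>2 + b\<^sup>2) ^ m"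
    using binomial_ring[of "b\<^sup>2" "a\<^sup>2" m] by (simp add: add.commute)
  finally show ?thesis .
qed

text \<open>Minkowski's inequality in L2. Convexity in the shift is what lets the scalar two-point
  inequality act on vector-valued sums.\<close>

lemma sqrt_avg_square_convex:
  fixes S :: "'a \<Rightarrow> 'e::real_normed_vector" and A :: "'a set"
  assumes "0 \<le> t" "t \<le> 1"
  defines "L \<equiv> \<lambda>w. sqrt (avg A (\<lambda>\<epsilon>. (norm (w + S \<epsilon>))\<^sup>2))"
  shows "L ((1 - t) *\<^sub>R u + t *\<^sub>R v) \<le> (1 - t) * L u + t * L v"
proof -
  have L: "L w = L2_set (\<lambda>\<epsilon>. norm (w + S \<epsilon>)) A / sqrt (card A)" for w
    by (simp add: L_def L2_set_def avg_def real_sqrt_divide)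
  have "L2_set (\<lambda>\<epsilon>. norm ((1 - t) *\<^sub>R u + t *\<^sub>R v + S \<epsilon>)) A
      \<le> L2_set (\<lambda>\<epsilon>. (1 - t) * norm (u + S \<epsilon>) + t * norm (v + S \<epsilon>)) A"
  proof (rule L2_set_mono)
    fix \<epsilon>
    have "(1 - t) *\<^sub>R u + t *\<^sub>R v + S \<epsilon> = (1 - t) *\<^sub>R (u + S \<epsilon>) + t *\<^sub>R (v + S \<epsilon>)"
      by (simp add: algebra_simps)
    also have "norm \<dots> \<le> (1 - t) * norm (u + S \<epsilon>) + t * norm (v + S \<epsilon>)"
      by (rule norm_triangle_le) (use assms in simp)
    finally show "norm ((1 - t) *\<^sub>R u + t *\<^sub>R v + S \<epsilon>) \<le> (1 - t) * norm (u + S \<epsilon>) + t * norm (v + S \<epsilon>)" .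
  qed simp
  also have "\<dots> \<le> L2_set (\<lambda>\<epsilon>. (1 - t) * norm (u + S \<epsilon>)) A + L2_set (\<lambda>\<epsilon>. t * norm (v + S \<epsilon>)) A"
    by (rule L2_set_triangle_ineq)
  also have "\<dots> = (1 - t) * L2_set (\<lambda>\<epsilon>. norm (u + S \<epsilon>)) A + t * L2_set (\<lambda>\<epsilon>. norm (v + S \<epsilon>)) A"
    using assms by (simp add: L2_set_right_distrib)
  finally have "L2_set (\<lambda>\<epsilon>. norm ((1 - t) *\<^sub>R u + t *\<^sub>R v + S \<epsilon>)) A / sqrt (card A)
      \<le> ((1 - t) * L2_set (\<lambda>\<epsilon>. norm (u + S \<epsilon>)) A + t * L2_set (\<lambda>\<epsilon>. norm (v + S \<epsilon>)) A) / sqrt (card A)"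
    by (rule divide_right_mono) simp
  then show ?thesis by (simp only: L add_divide_distrib times_divide_eq_right)
qed

text \<open>The shift \<open>z\<close> is there for the induction: the last sign is absorbed into
  it, giving the shifts \<open>z + \<rho> *\<^sub>R x n\<close> and
  \<open>z - \<rho> *\<^sub>R x n\<close>. Convexity bounds \<open>L\<close> at these two by the
  affine interpolation between its values \<open>P\<close> and \<open>Q\<close> at
  \<open>z + x n\<close> and \<open>z - x n\<close>, that is by a + \<rho> b and a - \<rho> b. The
  two-point inequality then closes the step, because a and b are half-sum and half-difference of
  \<open>P\<close> and \<open>Q\<close>, so that the sum of their squares is the mean of the squares
  of \<open>P\<close> and \<open>Q\<close>.\<close>

lemma rademacher_hypercontractive:
  fixes x :: "nat \<Rightarrow> 'e::real_normed_vector"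
  assumes "0 < m" defines "\<rho> \<equiv> 1 / real (2 * m)"
  shows "avg (signs n) (\<lambda>\<epsilon>. norm (z + \<rho> *\<^sub>R (\<Sum>i<n. \<epsilon> i *\<^sub>R x i)) ^ (2 * m))
    \<le> avg (signs n) (\<lambda>\<epsilon>. (norm (z + (\<Sum>i<n. \<epsilon> i *\<^sub>R x i)))\<^sup>2) ^ m"
proof (induction n arbitrary: z)
  case 0
  show ?case by (simp add: avg_const finite_signs signs_nonempty power_mult)
next
  case (Suc n)
  have sum_upd: "(\<Sum>i<Suc n. (\<epsilon>(n := c)) i *\<^sub>R x i) = (\<Sum>i<n. \<epsilon> i *\<^sub>R x i) + c *\<^sub>R x n" for \<epsilon> c
    by simp
  have split: "z + c *\<^sub>R (s + 1 *\<^sub>R v) = (z + c *\<^sub>R v) + c *\<^sub>R s"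
    "z + c *\<^sub>R (s + (- 1) *\<^sub>R v) = (z - c *\<^sub>R v) + c *\<^sub>R s" for c and s v :: 'e
    by (simp_all add: scaleR_add_right scaleR_diff_right)
  define L where "L w = sqrt (avg (signs n) (\<lambda>\<epsilon>. (norm (w + (\<Sum>i<n. \<epsilon> i *\<^sub>R x i)))\<^sup>2))" for w
  have L0: "0 \<le> L w" and L2: "(L w)\<^sup>2 = avg (signs n) (\<lambda>\<epsilon>. (norm (w + (\<Sum>i<n. \<epsilon> i *\<^sub>R x i)))\<^sup>2)" for w
    by (auto simp: L_def avg_nonneg)
  have IH: "avg (signs n) (\<lambda>\<epsilon>. norm (w + \<rho> *\<^sub>R (\<Sum>i<n. \<epsilon> i *\<^sub>R x i)) ^ (2 * m)) \<le> L w ^ (2 * m)" for w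
    using Suc.IH[of w] by (simp add: L2 power_mult)
  define P Q where "P = L (z + x n)" and "Q = L (z - x n)"
  define a b where "a = (P + Q) / 2" and "b = (P - Q) / 2"
  have \<rho>: "0 \<le> \<rho>" "\<rho> \<le> 1" using assms(1) by (auto simp: \<rho>_def)
  have conv: "L (z + c *\<^sub>R x n) \<le> a + c * b" if "- 1 \<le> c" "c \<le> 1" for c
  proof -
    define t where "t = (1 - c) / 2"
    then have c: "c = 1 - 2 * t" by simp
    have "(2 * t) *\<^sub>R x n = t *\<^sub>R x n + t *\<^sub>R x n" by (simp flip: scaleR_add_left)
    then have "z + c *\<^sub>R x n = (1 - t) *\<^sub>R (z + x n) + t *\<^sub>R (z - x n)"
      unfolding c by (simp add: scaleR_left_diff_distrib scaleR_right_diff_distrib scaleR_add_right)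
    moreover have "L ((1 - t) *\<^sub>R (z + x n) + t *\<^sub>R (z - x n)) \<le> (1 - t) * P + t * Q"
      unfolding L_def P_def Q_def using that by (intro sqrt_avg_square_convex) (auto simp: t_def)
    moreover have "(1 - t) * P + t * Q = a + c * b"
      unfolding a_def b_def c by (simp add: field_simps)
    ultimately show ?thesis by (simp only:)
  qed
  have plus: "L (z + \<rho> *\<^sub>R x n) \<le> a + \<rho> * b" and minus: "L (z - \<rho> *\<^sub>R x n) \<le> a - \<rho> * b"
    using conv[of \<rho>] conv[of "- \<rho>"] \<rho> by simp_all
  have "avg (signs (Suc n)) (\<lambda>\<epsilon>. norm (z + \<rho> *\<^sub>R (\<Sum>i<Suc n. \<epsilon> i *\<^sub>R x i)) ^ (2 * m))
      = (avg (signs n) (\<lambda>\<epsilon>. norm ((z + \<rho> *\<^sub>R x n) + \<rho> *\<^sub>R (\<Sum>i<n. \<epsilon> i *\<^sub>R x i)) ^ (2 * m))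
        + avg (signs n) (\<lambda>\<epsilon>. norm ((z - \<rho> *\<^sub>R x n) + \<rho> *\<^sub>R (\<Sum>i<n. \<epsilon> i *\<^sub>R x i)) ^ (2 * m))) / 2"
    by (simp only: avg_signs_Suc sum_upd split)
  also have "\<dots> \<le> (L (z + \<rho> *\<^sub>R x n) ^ (2 * m) + L (z - \<rho> *\<^sub>R x n) ^ (2 * m)) / 2"
    using IH by (intro divide_right_mono add_mono) auto
  also have "\<dots> \<le> ((a + \<rho> * b) ^ (2 * m) + (a - \<rho> * b) ^ (2 * m)) / 2"
    using plus minus L0 by (intro divide_right_mono add_mono power_mono) auto
  also have "\<dots> \<le> (a\<^sup>2 + b\<^sup>2) ^ m"
    unfolding \<rho>_def by (rule two_point_hypercontractive[OF assms(1)])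
  also have "a\<^sup>2 + b\<^sup>2 = (P\<^sup>2 + Q\<^sup>2) / 2"
    by (simp add: a_def b_def power2_eq_square field_simps)
  also have "\<dots> = avg (signs (Suc n)) (\<lambda>\<epsilon>. (norm (z + (\<Sum>i<Suc n. \<epsilon> i *\<^sub>R x i)))\<^sup>2)"
    using split[of 1] by (simp only: avg_signs_Suc sum_upd L2 P_def Q_def scaleR_one)
  finally show ?case .
qed

section \<open>Type and cotype\<close>

text \<open>A fourth moment comparable to the squared variance prevents the mass of \<open>X\<close>
  from sitting on rare large values, so truncation bounds the second moment by the first. The factor
  256 is the fourth power of 4, which is what hypercontractivity gives for m = 2.\<close>

lemma avg_square_le_of_fourth_moment:
  assumes "finite A" "A \<noteq> {}" and X: "\<And>a. a \<in> A \<Longrightarrow> 0 \<le> X a"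
    and fourth: "avg A (\<lambda>a. X a ^ 4) \<le> 256 * (avg A (\<lambda>a. (X a)\<^sup>2))\<^sup>2"
  shows "avg A (\<lambda>a. (X a)\<^sup>2) \<le> (43 * avg A X)\<^sup>2"
proof -
  define \<sigma> where "\<sigma> = sqrt (avg A (\<lambda>a. (X a)\<^sup>2))"
  have \<sigma>2: "avg A (\<lambda>a. (X a)\<^sup>2) = \<sigma>\<^sup>2" by (simp add: \<sigma>_def avg_nonneg)
  show ?thesis
  proof (cases "\<sigma> = 0")
    case True
    then show ?thesis by (simp add: \<sigma>2)
  next
    case False
    then have \<sigma>: "0 < \<sigma>" unfolding \<sigma>_def by (simp add: avg_nonneg order.not_eq_order_implies_strict)
    \<comment> \<open>Truncation at 32 \<sigma>: the averaged fourth-power term is at most 256 /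
      1024 = 1/4 of the second moment and is absorbed on the left. What remains is 3 \<sigma> \<le>
      128 \<open>avg A X\<close>, and 128 / 3 < 43.\<close>
    have "(X a)\<^sup>2 \<le> 32 * \<sigma> * X a + 1 / (1024 * \<sigma>\<^sup>2) * X a ^ 4" if "a \<in> A" for a
    proof (cases "X a \<le> 32 * \<sigma>")
      case True
      then have "(X a)\<^sup>2 \<le> 32 * \<sigma> * X a"
        unfolding power2_eq_square using X[OF that] by (intro mult_right_mono)
      moreover have "0 \<le> 1 / (1024 * \<sigma>\<^sup>2) * X a ^ 4" by simp
      ultimately show ?thesis by linarith
    next
      case False
      have "(32 * \<sigma>)\<^sup>2 * (X a)\<^sup>2 \<le> (X a)\<^sup>2 * (X a)\<^sup>2"
        using False \<sigma> by (intro mult_right_mono power_mono) auto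
      then have "(X a)\<^sup>2 \<le> 1 / (1024 * \<sigma>\<^sup>2) * X a ^ 4"
        using \<sigma> by (simp add: field_simps power2_eq_square power4_eq_xxxx)
      then show ?thesis using \<sigma> X[OF that] by (simp add: add_increasing)
    qed
    then have "avg A (\<lambda>a. (X a)\<^sup>2) \<le> avg A (\<lambda>a. 32 * \<sigma> * X a + 1 / (1024 * \<sigma>\<^sup>2) * X a ^ 4)"
      by (rule avg_mono)
    also have "\<dots> = 32 * \<sigma> * avg A X + 1 / (1024 * \<sigma>\<^sup>2) * avg A (\<lambda>a. X a ^ 4)"
      by (simp only: avg_add avg_cmult)
    also have "\<dots> \<le> 32 * \<sigma> * avg A X + 1 / (1024 * \<sigma>\<^sup>2) * (256 * (\<sigma>\<^sup>2)\<^sup>2)"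
      using fourth unfolding \<sigma>2 by (intro add_left_mono mult_left_mono) auto
    also have "1 / (1024 * \<sigma>\<^sup>2) * (256 * (\<sigma>\<^sup>2)\<^sup>2) = \<sigma> * \<sigma> / 4"
      using \<sigma> by (simp add: power2_eq_square)
    finally have "\<sigma> * \<sigma> \<le> 32 * (\<sigma> * avg A X) + \<sigma> * \<sigma> / 4"
      unfolding \<sigma>2 by (simp add: power2_eq_square mult.assoc)
    then have "\<sigma> * (3 * \<sigma>) \<le> \<sigma> * (128 * avg A X)"
      unfolding mult.left_commute[of \<sigma>] by linarith
    then have "3 * \<sigma> \<le> 128 * avg A X" using \<sigma> by (rule mult_left_le_imp_le)
    then have "\<sigma> \<le> 43 * avg A X" using \<sigma> by linarith
    then show ?thesis unfolding \<sigma>2 using \<sigma> by (intro power_mono) auto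
  qed
qed

text \<open>The moments are lowered in four stages: from q to 2m by Jensen, from 2m to 2 by
  hypercontractivity, from 2 to 1 by truncation, and from 1 to p by Jensen again. The right side
  carries a p-th moment without a root, so it can be averaged over a net.\<close>

lemma Kahane_inequality:
  fixes p q :: real
  assumes "1 \<le> p" "1 \<le> q"
  shows "\<exists>C\<ge>0. \<forall>n (x :: nat \<Rightarrow> 'e::real_normed_vector).
    avg (signs n) (\<lambda>\<epsilon>. norm (\<Sum>i<n. \<epsilon> i *\<^sub>R x i) powr q) powr (p / q)
      \<le> C * avg (signs n) (\<lambda>\<epsilon>. norm (\<Sum>i<n. \<epsilon> i *\<^sub>R x i) powr p)"
proof -
  \<comment> \<open>Hypercontractivity is available for even exponents, so \<open>q\<close> is
    rounded up to such a 2m. The final factor 86 m is 2m, the inverse of \<rho>, times the 43 of the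
    truncation.\<close>
  define m where "m = nat \<lceil>q\<rceil>"
  have m: "0 < m" "q \<le> real (2 * m)" using assms(2) by (auto simp: m_def; linarith)+
  have "avg (signs n) (\<lambda>\<epsilon>. norm (\<Sum>i<n. \<epsilon> i *\<^sub>R x i) powr q) powr (p / q)
      \<le> real (86 * m) powr p * avg (signs n) (\<lambda>\<epsilon>. norm (\<Sum>i<n. \<epsilon> i *\<^sub>R x i) powr p)"
    for n and x :: "nat \<Rightarrow> 'e"
  proof -
    define X where "X \<epsilon> = norm (\<Sum>i<n. \<epsilon> i *\<^sub>R x i)" for \<epsilon>
    define A where "A = signs n"
    have A: "finite A" "A \<noteq> {}" by (simp_all add: A_def finite_signs signs_nonempty)
    have X: "0 \<le> X \<epsilon>" for \<epsilon> by (simp add: X_def)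
    have hyper: "avg A (\<lambda>\<epsilon>. X \<epsilon> ^ (2 * k)) \<le> real (2 * k) ^ (2 * k) * avg A (\<lambda>\<epsilon>. (X \<epsilon>)\<^sup>2) ^ k"
      if "0 < k" for k
    proof -
      have "avg A (\<lambda>\<epsilon>. (1 / real (2 * k)) ^ (2 * k) * X \<epsilon> ^ (2 * k)) \<le> avg A (\<lambda>\<epsilon>. (X \<epsilon>)\<^sup>2) ^ k"
        using rademacher_hypercontractive[OF that, of n 0 x]
        by (simp add: A_def X_def power_mult_distrib power_divide)
      then show ?thesis unfolding avg_cmult using that by (simp add: power_divide divide_le_eq mult.commute)
    qed
    have "avg A (\<lambda>\<epsilon>. (X \<epsilon>)\<^sup>2) \<le> (43 * avg A X)\<^sup>2"
      using hyper[of 2] by (intro avg_square_le_of_fourth_moment A X) simp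
    then have "avg A (\<lambda>\<epsilon>. (X \<epsilon>)\<^sup>2) ^ m \<le> (43 * avg A X) ^ (2 * m)"
      unfolding power_mult by (intro power_mono avg_nonneg) auto
    then have "real (2 * m) ^ (2 * m) * avg A (\<lambda>\<epsilon>. (X \<epsilon>)\<^sup>2) ^ m \<le> real (2 * m) ^ (2 * m) * (43 * avg A X) ^ (2 * m)"
      by (rule mult_left_mono) simp
    also have "\<dots> = (real (2 * m) * (43 * avg A X)) ^ (2 * m)"
      by (rule power_mult_distrib[symmetric])
    also have "real (2 * m) * (43 * avg A X) = real (86 * m) * avg A X" by simp
    finally have even: "avg A (\<lambda>\<epsilon>. X \<epsilon> ^ (2 * m)) \<le> (real (86 * m) * avg A X) ^ (2 * m)"
      using hyper[OF m(1)] by linarith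
    have avgX: "0 \<le> avg A X" using X by (intro avg_nonneg)
    have pow: "y powr real (2 * m) = y ^ (2 * m)" if "0 \<le> y" for y :: real
      using that m(1) by (intro powr_realpow') auto
    have "avg A (\<lambda>\<epsilon>. X \<epsilon> powr q) powr (real (2 * m) / q) \<le> avg A (\<lambda>\<epsilon>. (X \<epsilon> powr q) powr (real (2 * m) / q))"
      using m assms(2) by (intro avg_powr_le A) auto
    also have "\<dots> = avg A (\<lambda>\<epsilon>. X \<epsilon> ^ (2 * m))"
      using assms(2) pow[OF X] by (simp add: powr_powr)
    also note even
    also have "(real (86 * m) * avg A X) ^ (2 * m) = (real (86 * m) * avg A X) powr real (2 * m)"
      using avgX by (intro pow[symmetric]) auto
    finally have "(avg A (\<lambda>\<epsilon>. X \<epsilon> powr q) powr (real (2 * m) / q)) powr (p / real (2 * m))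
        \<le> ((real (86 * m) * avg A X) powr real (2 * m)) powr (p / real (2 * m))"
      using assms by (intro powr_mono2) auto
    moreover have "real (2 * m) / q * (p / real (2 * m)) = p / q" "real (2 * m) * (p / real (2 * m)) = p"
      using m(1) by simp_all
    ultimately have "avg A (\<lambda>\<epsilon>. X \<epsilon> powr q) powr (p / q) \<le> (real (86 * m) * avg A X) powr p"
      by (simp only: powr_powr)
    also have "\<dots> = real (86 * m) powr p * avg A X powr p"
      by (rule powr_mult)
    also have "\<dots> \<le> real (86 * m) powr p * avg A (\<lambda>\<epsilon>. X \<epsilon> powr p)"
      using assms(1) X by (intro mult_left_mono avg_powr_le A) auto
    finally show ?thesis by (simp add: A_def X_def)
  qed
  then show ?thesis by (intro exI[of _ "real (86 * m) powr p"]) simp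
qed

text \<open>Strips the outer roots from type and cotype, which makes both inequalities linear in the
  expectation. The constants in the definitions carry no sign, hence the absolute value.\<close>

lemma powr_inverse_le_iff:
  fixes a b p :: real
  assumes "0 \<le> a" "0 \<le> b" "0 < p"
  shows "a powr (1 / p) \<le> C * b powr (1 / p) \<Longrightarrow> a \<le> \<bar>C\<bar> powr p * b"
    and "0 \<le> C \<Longrightarrow> a \<le> C * b \<Longrightarrow> a powr (1 / p) \<le> C powr (1 / p) * b powr (1 / p)"
proof -
  assume "a powr (1 / p) \<le> C * b powr (1 / p)"
  also have "\<dots> \<le> \<bar>C\<bar> * b powr (1 / p)" by (intro mult_right_mono) auto
  finally have "(a powr (1 / p)) powr p \<le> (\<bar>C\<bar> * b powr (1 / p)) powr p"
    using assms by (intro powr_mono2) auto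
  then show "a \<le> \<bar>C\<bar> powr p * b" using assms by (simp add: powr_powr powr_mult)
next
  assume "0 \<le> C" "a \<le> C * b"
  then have "a powr (1 / p) \<le> (C * b) powr (1 / p)" using assms by (intro powr_mono2) auto
  then show "a powr (1 / p) \<le> C powr (1 / p) * b powr (1 / p)"
    using assms \<open>0 \<le> C\<close> by (simp add: powr_mult)
qed

lemma has_type_iff:
  assumes "0 < p"
  shows "has_type V p \<longleftrightarrow> (\<exists>C\<ge>0. \<forall>n x. (\<forall>i<n. x i \<in> V) \<longrightarrow>
    avg (signs n) (\<lambda>\<epsilon>. norm (\<Sum>i<n. \<epsilon> i *\<^sub>R x i) powr p) \<le> C * (\<Sum>i<n. norm (x i) powr p))"
  (is "_ \<longleftrightarrow> (\<exists>C\<ge>0. ?P C)")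
proof
  assume "has_type V p"
  then obtain C where C: "\<And>n x. (\<forall>i<n. x i \<in> V) \<Longrightarrow>
      avg (signs n) (\<lambda>\<epsilon>. norm (\<Sum>i<n. \<epsilon> i *\<^sub>R x i) powr p) powr (1 / p)
        \<le> C * (\<Sum>i<n. norm (x i) powr p) powr (1 / p)"
    unfolding has_type_def expectation_rademacher_pmf by blast
  have "?P (\<bar>C\<bar> powr p)"
    by (intro allI impI powr_inverse_le_iff(1) C avg_nonneg sum_nonneg) (use assms in auto)
  then show "\<exists>C\<ge>0. ?P C" using powr_ge_zero by blast
next
  assume "\<exists>C\<ge>0. ?P C"
  then obtain C where C: "0 \<le> C" "?P C" by blast
  show "has_type V p"
    unfolding has_type_def expectation_rademacher_pmf
    by (intro exI[of _ "C powr (1 / p)"] allI impI powr_inverse_le_iff(2) avg_nonneg sum_nonneg)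
      (use assms C in auto)
qed

lemma has_finite_cotype_iff:
  assumes "0 < q"
  shows "has_finite_cotype V q \<longleftrightarrow> (\<exists>C\<ge>0. \<forall>n x. (\<forall>i<n. x i \<in> V) \<longrightarrow>
    (\<Sum>i<n. norm (x i) powr q) \<le> C * avg (signs n) (\<lambda>\<epsilon>. norm (\<Sum>i<n. \<epsilon> i *\<^sub>R x i) powr q))"
  (is "_ \<longleftrightarrow> (\<exists>C\<ge>0. ?P C)")
proof
  assume "has_finite_cotype V q"
  then obtain C where C: "\<And>n x. (\<forall>i<n. x i \<in> V) \<Longrightarrow>
      (\<Sum>i<n. norm (x i) powr q) powr (1 / q)
        \<le> C * avg (signs n) (\<lambda>\<epsilon>. norm (\<Sum>i<n. \<epsilon> i *\<^sub>R x i) powr q) powr (1 / q)"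
    unfolding has_finite_cotype_def expectation_rademacher_pmf by blast
  have "?P (\<bar>C\<bar> powr q)"
    by (intro allI impI powr_inverse_le_iff(1) C avg_nonneg sum_nonneg) (use assms in auto)
  then show "\<exists>C\<ge>0. ?P C" using powr_ge_zero by blast
next
  assume "\<exists>C\<ge>0. ?P C"
  then obtain C where C: "0 \<le> C" "?P C" by blast
  show "has_finite_cotype V q"
    unfolding has_finite_cotype_def expectation_rademacher_pmf
    by (intro exI[of _ "C powr (1 / q)"] allI impI powr_inverse_le_iff(2) avg_nonneg sum_nonneg)
      (use assms C in auto)
qed

section \<open>Type and cotype of closures\<close>

lemma closure_tuple_sequential:
  fixes x :: "nat \<Rightarrow> 'a::metric_space"
  assumes "\<forall>i<n. x i \<in> closure V"
  shows "\<exists>y. (\<forall>k. \<forall>i<n. y k i \<in> V) \<and> (\<forall>i<n. (\<lambda>k. y k i) \<longlonglongrightarrow> x i)"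
proof -
  have "\<exists>z. i < n \<longrightarrow> (\<forall>k. z k \<in> V) \<and> z \<longlonglongrightarrow> x i" for i
    using assms by (meson closure_sequential)
  then obtain z where "\<And>i. i < n \<longrightarrow> (\<forall>k. z i k \<in> V) \<and> z i \<longlonglongrightarrow> x i" by metis
  then show ?thesis by (intro exI[of _ "\<lambda>k i. z i k"]) auto
qed

lemma tendsto_avg_powr_norm_sum:
  fixes x :: "nat \<Rightarrow> 'a::real_normed_vector"
  assumes "\<And>i. i < n \<Longrightarrow> ((\<lambda>k. y k i) \<longlongrightarrow> x i) F" "0 < r"
  shows "((\<lambda>k. avg A (\<lambda>\<epsilon>. norm (\<Sum>i<n. \<epsilon> i *\<^sub>R y k i) powr r))
    \<longlongrightarrow> avg A (\<lambda>\<epsilon>. norm (\<Sum>i<n. \<epsilon> i *\<^sub>R x i) powr r)) F"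
  unfolding avg_def divide_inverse
  by (intro tendsto_mult tendsto_const tendsto_sum tendsto_powr2 tendsto_norm tendsto_scaleR)
    (use assms in auto)

lemma tendsto_sum_powr_norm:
  fixes x :: "nat \<Rightarrow> 'a::real_normed_vector"
  assumes "\<And>i. i < n \<Longrightarrow> ((\<lambda>k. y k i) \<longlongrightarrow> x i) F" "0 < r"
  shows "((\<lambda>k. \<Sum>i<n. norm (y k i) powr r) \<longlongrightarrow> (\<Sum>i<n. norm (x i) powr r)) F"
  by (intro tendsto_const tendsto_sum tendsto_powr2 tendsto_norm) (use assms in auto)

lemma has_type_closure:
  assumes "has_type V p" "0 < p"
  shows "has_type (closure V) p"
proof -
  obtain C where C: "0 \<le> C" "\<And>n x. (\<forall>i<n. x i \<in> V) \<Longrightarrow>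
      avg (signs n) (\<lambda>\<epsilon>. norm (\<Sum>i<n. \<epsilon> i *\<^sub>R x i) powr p) \<le> C * (\<Sum>i<n. norm (x i) powr p)"
    using assms unfolding has_type_iff[OF assms(2)] by blast
  have "avg (signs n) (\<lambda>\<epsilon>. norm (\<Sum>i<n. \<epsilon> i *\<^sub>R x i) powr p) \<le> C * (\<Sum>i<n. norm (x i) powr p)"
    if x: "\<forall>i<n. x i \<in> closure V" for n x
  proof -
    obtain y where y: "\<forall>k. \<forall>i<n. y k i \<in> V" "\<forall>i<n. (\<lambda>k. y k i) \<longlonglongrightarrow> x i"
      using closure_tuple_sequential[OF x] by blast
    show ?thesis
    proof (rule LIMSEQ_le)
      show "(\<lambda>k. avg (signs n) (\<lambda>\<epsilon>. norm (\<Sum>i<n. \<epsilon> i *\<^sub>R y k i) powr p))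
          \<longlonglongrightarrow> avg (signs n) (\<lambda>\<epsilon>. norm (\<Sum>i<n. \<epsilon> i *\<^sub>R x i) powr p)"
        by (rule tendsto_avg_powr_norm_sum[OF y(2)[rule_format] assms(2)])
      show "(\<lambda>k. C * (\<Sum>i<n. norm (y k i) powr p)) \<longlonglongrightarrow> C * (\<Sum>i<n. norm (x i) powr p)"
        by (rule tendsto_mult_left[OF tendsto_sum_powr_norm[OF y(2)[rule_format] assms(2)]])
    qed (use C(2) y(1) in blast)
  qed
  with C(1) show ?thesis unfolding has_type_iff[OF assms(2)] by blast
qed

lemma has_finite_cotype_closure:
  assumes "has_finite_cotype V q" "0 < q"
  shows "has_finite_cotype (closure V) q"
proof -
  obtain C where C: "0 \<le> C" "\<And>n x. (\<forall>i<n. x i \<in> V) \<Longrightarrow>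
      (\<Sum>i<n. norm (x i) powr q) \<le> C * avg (signs n) (\<lambda>\<epsilon>. norm (\<Sum>i<n. \<epsilon> i *\<^sub>R x i) powr q)"
    using assms unfolding has_finite_cotype_iff[OF assms(2)] by blast
  have "(\<Sum>i<n. norm (x i) powr q) \<le> C * avg (signs n) (\<lambda>\<epsilon>. norm (\<Sum>i<n. \<epsilon> i *\<^sub>R x i) powr q)"
    if x: "\<forall>i<n. x i \<in> closure V" for n x
  proof -
    obtain y where y: "\<forall>k. \<forall>i<n. y k i \<in> V" "\<forall>i<n. (\<lambda>k. y k i) \<longlonglongrightarrow> x i"
      using closure_tuple_sequential[OF x] by blast
    show ?thesis
    proof (rule LIMSEQ_le)
      show "(\<lambda>k. C * avg (signs n) (\<lambda>\<epsilon>. norm (\<Sum>i<n. \<epsilon> i *\<^sub>R y k i) powr q))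
          \<longlonglongrightarrow> C * avg (signs n) (\<lambda>\<epsilon>. norm (\<Sum>i<n. \<epsilon> i *\<^sub>R x i) powr q)"
        by (rule tendsto_mult_left[OF tendsto_avg_powr_norm_sum[OF y(2)[rule_format] assms(2)]])
      show "(\<lambda>k. \<Sum>i<n. norm (y k i) powr q) \<longlonglongrightarrow> (\<Sum>i<n. norm (x i) powr q)"
        by (rule tendsto_sum_powr_norm[OF y(2)[rule_format] assms(2)])
    qed (use C(2) y(1) in blast)
  qed
  with C(1) show ?thesis unfolding has_finite_cotype_iff[OF assms(2)] by blast
qed

section \<open>Type and cotype of averaged seminorms\<close>

lemma has_type_avg:
  fixes p :: real
  assumes "has_type (UNIV :: 'e::real_normed_vector set) p" "0 < p"
  obtains C where "0 \<le> C" "\<And>n A (f :: nat \<Rightarrow> 'a \<Rightarrow> 'e).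
    avg (signs n) (\<lambda>\<epsilon>. avg A (\<lambda>a. norm (\<Sum>i<n. \<epsilon> i *\<^sub>R f i a) powr p))
      \<le> C * (\<Sum>i<n. avg A (\<lambda>a. norm (f i a) powr p))"
proof -
  obtain C where C: "0 \<le> C" "\<forall>n (x :: nat \<Rightarrow> 'e).
      avg (signs n) (\<lambda>\<epsilon>. norm (\<Sum>i<n. \<epsilon> i *\<^sub>R x i) powr p) \<le> C * (\<Sum>i<n. norm (x i) powr p)"
    using assms(1) unfolding has_type_iff[OF assms(2)] by blast
  have "avg (signs n) (\<lambda>\<epsilon>. avg A (\<lambda>a. norm (\<Sum>i<n. \<epsilon> i *\<^sub>R f i a) powr p))
      \<le> C * (\<Sum>i<n. avg A (\<lambda>a. norm (f i a) powr p))" for n A and f :: "nat \<Rightarrow> 'a \<Rightarrow> 'e"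
    unfolding avg_swap[of "signs n"] avg_sum[symmetric] avg_cmult[symmetric]
    by (intro avg_mono C(2)[rule_format])
  with C(1) show thesis by (rule that)
qed

text \<open>With s = q / p, Minkowski moves the s-norm over \<open>i\<close> inside the average over
  \<open>A\<close>. There the cotype of E applies pointwise but produces a q-th moment of the signs;
  Kahane's inequality turns it into a p-th moment, which commutes with the average over
  \<open>A\<close>. Jensen over the signs restores the power s at the end.\<close>

lemma has_finite_cotype_avg:
  fixes p q :: real
  assumes "has_finite_cotype (UNIV :: 'e::real_normed_vector set) q" "1 \<le> p" "p \<le> q"
  obtains C where "0 \<le> C" "\<And>n A (f :: nat \<Rightarrow> 'a \<Rightarrow> 'e). finite A \<Longrightarrow> A \<noteq> {} \<Longrightarrow>
    (\<Sum>i<n. avg A (\<lambda>a. norm (f i a) powr p) powr (q / p))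
      \<le> C * avg (signs n) (\<lambda>\<epsilon>. avg A (\<lambda>a. norm (\<Sum>i<n. \<epsilon> i *\<^sub>R f i a) powr p) powr (q / p))"
proof -
  have q: "1 \<le> q" "0 < q" using assms by auto
  obtain K where K: "0 \<le> K" "\<forall>n (x :: nat \<Rightarrow> 'e).
      (\<Sum>i<n. norm (x i) powr q) \<le> K * avg (signs n) (\<lambda>\<epsilon>. norm (\<Sum>i<n. \<epsilon> i *\<^sub>R x i) powr q)"
    using assms(1) unfolding has_finite_cotype_iff[OF q(2)] by blast
  obtain C where C: "0 \<le> C" "\<forall>n (x :: nat \<Rightarrow> 'e).
      avg (signs n) (\<lambda>\<epsilon>. norm (\<Sum>i<n. \<epsilon> i *\<^sub>R x i) powr q) powr (p / q)
        \<le> C * avg (signs n) (\<lambda>\<epsilon>. norm (\<Sum>i<n. \<epsilon> i *\<^sub>R x i) powr p)"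
    using Kahane_inequality[OF assms(2) q(1)] by blast
  define D where "D = K powr (p / q) * C"
  have D: "0 \<le> D" using C(1) by (simp add: D_def)
  define s where "s = q / p"
  have s: "1 \<le> s" "1 / s = p / q" using assms by (auto simp: s_def)
  have pointwise: "(\<Sum>i<n. norm (x i) powr q) powr (p / q)
      \<le> D * avg (signs n) (\<lambda>\<epsilon>. norm (\<Sum>i<n. \<epsilon> i *\<^sub>R x i) powr p)" for n and x :: "nat \<Rightarrow> 'e"
  proof -
    have "(\<Sum>i<n. norm (x i) powr q) powr (p / q)
        \<le> (K * avg (signs n) (\<lambda>\<epsilon>. norm (\<Sum>i<n. \<epsilon> i *\<^sub>R x i) powr q)) powr (p / q)"
      using assms q by (intro powr_mono2 sum_nonneg K(2)[rule_format]) auto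
    also have "\<dots> = K powr (p / q) * avg (signs n) (\<lambda>\<epsilon>. norm (\<Sum>i<n. \<epsilon> i *\<^sub>R x i) powr q) powr (p / q)"
      by (rule powr_mult)
    also have "\<dots> \<le> K powr (p / q) * (C * avg (signs n) (\<lambda>\<epsilon>. norm (\<Sum>i<n. \<epsilon> i *\<^sub>R x i) powr p))"
      by (intro mult_left_mono C(2)[rule_format]) auto
    finally show ?thesis by (simp add: D_def mult.assoc)
  qed
  have "(\<Sum>i<n. avg A (\<lambda>a. norm (f i a) powr p) powr s)
      \<le> D powr s * avg (signs n) (\<lambda>\<epsilon>. avg A (\<lambda>a. norm (\<Sum>i<n. \<epsilon> i *\<^sub>R f i a) powr p) powr s)"
    if A: "finite A" "A \<noteq> {}" for n A and f :: "nat \<Rightarrow> 'a \<Rightarrow> 'e"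
  proof -
    have "(\<Sum>i<n. avg A (\<lambda>a. norm (f i a) powr p) powr s) powr (1 / s)
        \<le> avg A (\<lambda>a. (\<Sum>i<n. (norm (f i a) powr p) powr s) powr (1 / s))"
      by (rule avg_Minkowski[OF A _ s(1)]) auto
    also have "\<dots> = avg A (\<lambda>a. (\<Sum>i<n. norm (f i a) powr q) powr (p / q))"
      using assms by (simp add: s powr_powr) (simp add: s_def)
    also have "\<dots> \<le> avg A (\<lambda>a. D * avg (signs n) (\<lambda>\<epsilon>. norm (\<Sum>i<n. \<epsilon> i *\<^sub>R f i a) powr p))"
      by (intro avg_mono pointwise)
    also have "\<dots> = D * avg (signs n) (\<lambda>\<epsilon>. avg A (\<lambda>a. norm (\<Sum>i<n. \<epsilon> i *\<^sub>R f i a) powr p))"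
      unfolding avg_cmult avg_swap[of A] ..
    finally have "((\<Sum>i<n. avg A (\<lambda>a. norm (f i a) powr p) powr s) powr (1 / s)) powr s
        \<le> (D * avg (signs n) (\<lambda>\<epsilon>. avg A (\<lambda>a. norm (\<Sum>i<n. \<epsilon> i *\<^sub>R f i a) powr p))) powr s"
      using s(1) by (intro powr_mono2) auto
    then have "(\<Sum>i<n. avg A (\<lambda>a. norm (f i a) powr p) powr s)
        \<le> (D * avg (signs n) (\<lambda>\<epsilon>. avg A (\<lambda>a. norm (\<Sum>i<n. \<epsilon> i *\<^sub>R f i a) powr p))) powr s"
      using s(1) by (simp add: powr_powr sum_nonneg)
    also have "\<dots> = D powr s * avg (signs n) (\<lambda>\<epsilon>. avg A (\<lambda>a. norm (\<Sum>i<n. \<epsilon> i *\<^sub>R f i a) powr p)) powr s"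
      by (rule powr_mult)
    also have "\<dots> \<le> D powr s * avg (signs n) (\<lambda>\<epsilon>. avg A (\<lambda>a. norm (\<Sum>i<n. \<epsilon> i *\<^sub>R f i a) powr p) powr s)"
      using s(1) by (intro mult_left_mono avg_powr_le finite_signs signs_nonempty avg_nonneg) auto
    finally show ?thesis .
  qed
  then show thesis unfolding s_def by (intro that[of "D powr (q / p)"]) auto
qed

text \<open>\<open>T\<close> need not be injective on \<open>Y\<close>, since \<open>N\<close> may
  vanish at nonzero vectors. Any choice of preimages works, because the inequality sees them only
  through \<open>N\<close>.\<close>

lemma has_type_isometric_image:
  assumes "0 < p" "linear T" "subspace Y" and norm: "\<And>y. y \<in> Y \<Longrightarrow> norm (T y) = N y"
    and N: "\<exists>C\<ge>0. \<forall>n f. avg (signs n) (\<lambda>\<epsilon>. N (\<Sum>i<n. \<epsilon> i *\<^sub>R f i) powr p) \<le> C * (\<Sum>i<n. N (f i) powr p)"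
  shows "has_type (T ` Y) p"
proof -
  obtain C where C: "0 \<le> C"
    "\<forall>n f. avg (signs n) (\<lambda>\<epsilon>. N (\<Sum>i<n. \<epsilon> i *\<^sub>R f i) powr p) \<le> C * (\<Sum>i<n. N (f i) powr p)"
    using N by blast
  have "avg (signs n) (\<lambda>\<epsilon>. norm (\<Sum>i<n. \<epsilon> i *\<^sub>R x i) powr p) \<le> C * (\<Sum>i<n. norm (x i) powr p)"
    if x: "\<forall>i<n. x i \<in> T ` Y" for n x
  proof -
    define y where "y i = inv_into Y T (x i)" for i
    have y: "y i \<in> Y" "T (y i) = x i" if "i < n" for i
      using x that by (simp_all add: y_def inv_into_into f_inv_into_f)
    have "norm (\<Sum>i<n. \<epsilon> i *\<^sub>R x i) = N (\<Sum>i<n. \<epsilon> i *\<^sub>R y i)" for \<epsilon>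
    proof -
      have "(\<Sum>i<n. \<epsilon> i *\<^sub>R x i) = T (\<Sum>i<n. \<epsilon> i *\<^sub>R y i)"
        using y(2) by (simp add: linear_sum[OF assms(2)] linear_scale[OF assms(2)])
      moreover have "(\<Sum>i<n. \<epsilon> i *\<^sub>R y i) \<in> Y"
        using y(1) by (intro subspace_sum[OF assms(3)] subspace_scale[OF assms(3)]) simp
      ultimately show ?thesis by (simp add: norm)
    qed
    moreover have "norm (x i) = N (y i)" if "i < n" for i
      using norm[OF y(1)[OF that]] y(2)[OF that] by simp
    ultimately show ?thesis using C(2) by simp
  qed
  then show ?thesis unfolding has_type_iff[OF assms(1)] using C(1) by blast
qed

lemma has_finite_cotype_isometric_image:
  assumes "0 < q" "linear T" "subspace Y" and norm: "\<And>y. y \<in> Y \<Longrightarrow> norm (T y) = N y"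
    and N: "\<exists>C\<ge>0. \<forall>n f. (\<Sum>i<n. N (f i) powr q) \<le> C * avg (signs n) (\<lambda>\<epsilon>. N (\<Sum>i<n. \<epsilon> i *\<^sub>R f i) powr q)"
  shows "has_finite_cotype (T ` Y) q"
proof -
  obtain C where C: "0 \<le> C"
    "\<forall>n f. (\<Sum>i<n. N (f i) powr q) \<le> C * avg (signs n) (\<lambda>\<epsilon>. N (\<Sum>i<n. \<epsilon> i *\<^sub>R f i) powr q)"
    using N by blast
  have "(\<Sum>i<n. norm (x i) powr q) \<le> C * avg (signs n) (\<lambda>\<epsilon>. norm (\<Sum>i<n. \<epsilon> i *\<^sub>R x i) powr q)"
    if x: "\<forall>i<n. x i \<in> T ` Y" for n x
  proof -
    define y where "y i = inv_into Y T (x i)" for i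
    have y: "y i \<in> Y" "T (y i) = x i" if "i < n" for i
      using x that by (simp_all add: y_def inv_into_into f_inv_into_f)
    have "norm (\<Sum>i<n. \<epsilon> i *\<^sub>R x i) = N (\<Sum>i<n. \<epsilon> i *\<^sub>R y i)" for \<epsilon>
    proof -
      have "(\<Sum>i<n. \<epsilon> i *\<^sub>R x i) = T (\<Sum>i<n. \<epsilon> i *\<^sub>R y i)"
        using y(2) by (simp add: linear_sum[OF assms(2)] linear_scale[OF assms(2)])
      moreover have "(\<Sum>i<n. \<epsilon> i *\<^sub>R y i) \<in> Y"
        using y(1) by (intro subspace_sum[OF assms(3)] subspace_scale[OF assms(3)]) simp
      ultimately show ?thesis by (simp add: norm)
    qed
    moreover have "norm (x i) = N (y i)" if "i < n" for i
      using norm[OF y(1)[OF that]] y(2)[OF that] by simp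
    ultimately show ?thesis using C(2) by simp
  qed
  then show ?thesis unfolding has_finite_cotype_iff[OF assms(1)] using C(1) by blast
qed

section \<open>Sublinear functionals\<close>

definition sublinear :: "('a::real_vector \<Rightarrow> real) \<Rightarrow> bool" where
  "sublinear s \<longleftrightarrow> (\<forall>x y. s (x + y) \<le> s x + s y) \<and> (\<forall>c x. 0 \<le> c \<longrightarrow> s (c *\<^sub>R x) = c * s x)"

lemma sublinearI:
  assumes "\<And>x y. s (x + y) \<le> s x + s y" "s 0 = 0"
    and "\<And>c x. 0 < c \<Longrightarrow> s (c *\<^sub>R x) \<le> c * s x"
  shows "sublinear s"
proof -
  have "c * s x \<le> s (c *\<^sub>R x)" if "0 < c" for c x
    using assms(3)[of "inverse c" "c *\<^sub>R x"] that by (simp add: field_simps)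
  then have "s (c *\<^sub>R x) = c * s x" if "0 \<le> c" for c x
    using assms(2) assms(3)[of c x] that by (cases "c = 0") (auto intro: antisym)
  with assms(1) show ?thesis by (auto simp: sublinear_def)
qed

lemma sublinearD:
  assumes "sublinear s"
  shows "s (x + y) \<le> s x + s y" "0 \<le> c \<Longrightarrow> s (c *\<^sub>R x) = c * s x" "s 0 = 0" "- s (- x) \<le> s x"
proof -
  show *: "s (x + y) \<le> s x + s y" "0 \<le> c \<Longrightarrow> s (c *\<^sub>R x) = c * s x" for x y c
    using assms by (auto simp: sublinear_def)
  show "s 0 = 0" using *(2)[of 0 0] by simp
  then show "- s (- x) \<le> s x" using *(1)[of x "- x"] by simp
qed

text \<open>The one-sided directional derivative of a sublinear functional at \<open>y\<close>.\<close>

lemma sublinear_directional: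
  assumes s: "sublinear s"
  obtains q where "sublinear q" "\<And>x. q x \<le> s x" "\<And>x. q x \<le> s (x + y) - s y"
proof
  \<comment> \<open>For t = 1 / h the expression is the difference quotient of \<open>s\<close> at
    \<open>y\<close> in direction \<open>x\<close> with step h; t = 0 contributes
    \<open>s x\<close>. Evaluation at \<open>- y\<close> with t = 1 gives a value at most
    \<open>- s y\<close>, which later forces equality at \<open>y\<close>.\<close>
  define q where "q x = (INF t\<in>{0..}. s (x + t *\<^sub>R y) - t * s y)" for x
  have lower: "- s (- x) \<le> s (x + t *\<^sub>R y) - t * s y" if "0 \<le> t" for x t
    using sublinearD(1)[OF s, of "x + t *\<^sub>R y" "- x"] sublinearD(2)[OF s that, of y] by simp
  have bdd: "bdd_below ((\<lambda>t. s (x + t *\<^sub>R y) - t * s y) ` {0..})" for x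
    using lower by (auto intro!: bdd_belowI2)
  have le: "q x \<le> s (x + t *\<^sub>R y) - t * s y" if "0 \<le> t" for x t
    unfolding q_def using bdd that by (auto intro: cINF_lower)
  have greatest: "c \<le> q x" if "\<And>t. 0 \<le> t \<Longrightarrow> c \<le> s (x + t *\<^sub>R y) - t * s y" for c x
    unfolding q_def using that by (auto intro!: cINF_greatest)
  show "sublinear q"
  proof (rule sublinearI)
    fix x x' :: 'a
    have "q (x + x') - (s (x' + u *\<^sub>R y) - u * s y) \<le> s (x + t *\<^sub>R y) - t * s y"
      if "0 \<le> t" "0 \<le> u" for t u
    proof -
      have "q (x + x') \<le> s (x + x' + (t + u) *\<^sub>R y) - (t + u) * s y"
        using that by (intro le) auto
      also have "x + x' + (t + u) *\<^sub>R y = (x + t *\<^sub>R y) + (x' + u *\<^sub>R y)"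
        by (simp add: algebra_simps)
      also have "s \<dots> \<le> s (x + t *\<^sub>R y) + s (x' + u *\<^sub>R y)" by (rule sublinearD(1)[OF s])
      finally show ?thesis by (simp add: algebra_simps)
    qed
    then have "q (x + x') - (s (x' + u *\<^sub>R y) - u * s y) \<le> q x" if "0 \<le> u" for u
      using that by (intro greatest) auto
    then have "q (x + x') - q x \<le> q x'" by (intro greatest) (simp add: algebra_simps)
    then show "q (x + x') \<le> q x + q x'" by simp
  next
    show "q 0 = 0"
      using le[of 0 0] greatest[of 0 0] sublinearD(2,3)[OF s] by (auto intro!: antisym)
  next
    fix c :: real and x :: 'a
    assume c: "0 < c"
    have "inverse c * q (c *\<^sub>R x) \<le> q x"
    proof (rule greatest)
      fix t :: real assume "0 \<le> t"
      then have "q (c *\<^sub>R x) \<le> s (c *\<^sub>R x + (c * t) *\<^sub>R y) - (c * t) * s y"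
        using c by (intro le) auto
      also have "c *\<^sub>R x + (c * t) *\<^sub>R y = c *\<^sub>R (x + t *\<^sub>R y)" by (simp add: algebra_simps)
      also have "s \<dots> = c * s (x + t *\<^sub>R y)" using c by (intro sublinearD(2)[OF s]) auto
      finally have "q (c *\<^sub>R x) \<le> c * (s (x + t *\<^sub>R y) - t * s y)" by (simp add: algebra_simps)
      then show "inverse c * q (c *\<^sub>R x) \<le> s (x + t *\<^sub>R y) - t * s y"
        using c by (simp add: field_simps)
    qed
    then show "q (c *\<^sub>R x) \<le> c * q x" using c by (simp add: field_simps)
  qed
  show "q x \<le> s x" "q x \<le> s (x + y) - s y" for x
    using le[of 0 x] le[of 1 x] by auto
qed

text \<open>Zorn's lemma for the reversed pointwise order. Members of a chain are bounded below by
  \<open>- s (- x)\<close>, so the pointwise infimum is finite. It is subadditive because two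
  members of the chain can be replaced by the smaller of them.\<close>

lemma minimal_sublinear_exists:
  assumes s: "sublinear s"
  obtains m where "sublinear m" "\<And>x. m x \<le> s x"
    "\<And>q. sublinear q \<Longrightarrow> (\<And>x. q x \<le> m x) \<Longrightarrow> q = m"
proof -
  define A where "A = {q. sublinear q \<and> (\<forall>x. q x \<le> s x)}"
  define P where "P q q' \<longleftrightarrow> (\<forall>x. q' x \<le> q x)" for q q' :: "'a \<Rightarrow> real"
  have "\<exists>m\<in>A. \<forall>q\<in>A. P m q \<longrightarrow> q = m"
  proof (rule predicate_Zorn)
    show "partial_order_on A (relation_of P A)"
      unfolding P_def
      by (rule partial_order_on_relation_ofI) (auto simp: fun_eq_iff intro: order_trans antisym)
    fix C assume C: "C \<in> Chains (relation_of P A)"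
    then have CA: "C \<subseteq> A" and chain: "\<And>q q'. q \<in> C \<Longrightarrow> q' \<in> C \<Longrightarrow> P q q' \<or> P q' q"
      by (auto simp: Chains_def relation_of_def)
    show "\<exists>u\<in>A. \<forall>q\<in>C. P q u"
    proof (cases "C = {}")
      case True
      then show ?thesis using s by (auto simp: A_def)
    next
      case False
      define u where "u x = (INF q\<in>C. q x)" for x
      have sub: "sublinear q" "q x \<le> s x" if "q \<in> C" for q x using CA that by (auto simp: A_def)
      have "- s (- x) \<le> q x" if "q \<in> C" for q x
        using sublinearD(4)[OF sub(1)[OF that], of x] sub(2)[OF that, of "- x"] by linarith
      then have "bdd_below ((\<lambda>q. q x) ` C)" for x
        by (auto intro!: bdd_belowI2)
      then have le: "u x \<le> q x" if "q \<in> C" for q x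
        unfolding u_def using that by (auto intro: cINF_lower)
      have greatest: "c \<le> u x" if "\<And>q. q \<in> C \<Longrightarrow> c \<le> q x" for c x
        unfolding u_def using that False by (auto intro!: cINF_greatest)
      have "sublinear u"
      proof (rule sublinearI)
        fix x y
        have "u (x + y) - q' y \<le> q x" if q: "q \<in> C" "q' \<in> C" for q q'
        proof -
          obtain r where r: "r \<in> C" "r x \<le> q x" "r y \<le> q' y"
            using chain[OF q] q by (auto simp: P_def)
          then show ?thesis using le[OF r(1), of "x + y"] sublinearD(1)[OF sub(1)[OF r(1)], of x y] by linarith
        qed
        then have "u (x + y) - q' y \<le> u x" if "q' \<in> C" for q' using that by (intro greatest)
        then have "u (x + y) - u x \<le> u y" by (intro greatest) (simp add: algebra_simps)
        then show "u (x + y) \<le> u x + u y" by simp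
      next
        have zero: "q 0 = 0" if "q \<in> C" for q using sublinearD(3)[OF sub(1)[OF that]] .
        obtain q where "q \<in> C" using False by blast
        then have "u 0 \<le> 0" using le[of q 0] zero[of q] by simp
        moreover have "0 \<le> u 0" by (rule greatest) (simp add: zero)
        ultimately show "u 0 = 0" by simp
      next
        fix c :: real and x assume c: "0 < c"
        have "inverse c * u (c *\<^sub>R x) \<le> u x"
          using le[of _ "c *\<^sub>R x"] sublinearD(2)[OF sub(1), of _ c x] c
          by (intro greatest) (simp add: field_simps)
        then show "u (c *\<^sub>R x) \<le> c * u x" using c by (simp add: field_simps)
      qed
      moreover have "u x \<le> s x" for x
        using False le sub(2) by (meson equals0I order_trans)
      ultimately show ?thesis using le by (auto simp: A_def P_def)
    qed
  qed
  then obtain m where m: "m \<in> A" "\<And>q. q \<in> A \<Longrightarrow> P m q \<Longrightarrow> q = m" by blast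
  show thesis
  proof
    show "sublinear m" "m x \<le> s x" for x using m(1) by (auto simp: A_def)
    show "q = m" if "sublinear q" "\<And>x. q x \<le> m x" for q
      using m that by (auto simp: A_def P_def intro: order_trans)
  qed
qed

text \<open>Hahn-Banach by minimality: the directional derivative of a minimal \<open>m\<close> at
  \<open>z\<close> lies below \<open>m\<close>, hence equals it, and this says that \<open>m\<close>
  is superadditive. Choosing \<open>m\<close> below the derivative of \<open>s\<close> at
  \<open>y\<close> gives \<open>m (- y) \<le> - s y\<close>, so the functional touches
  \<open>s\<close> at \<open>y\<close>.\<close>

lemma sublinear_support_functional:
  assumes s: "sublinear s"
  obtains l where "linear l" "\<And>x. l x \<le> s x" "l y = s y"
proof -
  obtain q where q: "sublinear q" "\<And>x. q x \<le> s x" "\<And>x. q x \<le> s (x + y) - s y"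
    using sublinear_directional[OF s] by metis
  obtain m where m: "sublinear m" "\<And>x. m x \<le> q x"
    "\<And>q. sublinear q \<Longrightarrow> (\<And>x. q x \<le> m x) \<Longrightarrow> q = m"
    using minimal_sublinear_exists[OF q(1)] by metis
  have add: "m (x + z) = m x + m z" for x z
  proof -
    obtain r where r: "sublinear r" "\<And>x. r x \<le> m x" "\<And>x. r x \<le> m (x + z) - m z"
      using sublinear_directional[OF m(1)] by metis
    then have "r = m" by (intro m(3))
    with r(3)[of x] sublinearD(1)[OF m(1), of x z] show ?thesis by simp
  qed
  have neg: "m (- x) = - m x" for x
    using add[of x "- x"] sublinearD(3)[OF m(1)] by simp
  have "m (c *\<^sub>R x) = c * m x" for c x
    using sublinearD(2)[OF m(1), of c x] sublinearD(2)[OF m(1), of "- c" x] neg[of "c *\<^sub>R x"]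
    by (cases "0 \<le> c") auto
  with add have "linear m" by (intro linearI) auto
  moreover have "m x \<le> s x" for x using m(2)[of x] q(2)[of x] by linarith
  moreover have "m (- y) \<le> - s y" using m(2)[of "- y"] q(3)[of "- y"] sublinearD(3)[OF s] by simp
  ultimately show thesis using that neg[of y] by (metis antisym neg_le_iff_le)
qed

text \<open>Coordinates are support functionals of the seminorm at the points of a dense sequence.\<close>

lemma seminorm_isometric_into_linfty:
  fixes N :: "'a::real_vector \<Rightarrow> real" and D :: "nat \<Rightarrow> 'a"
  assumes add: "\<And>x y. N (x + y) \<le> N x + N y" and scale: "\<And>c x. N (c *\<^sub>R x) = \<bar>c\<bar> * N x"
    and dense: "\<And>y e. y \<in> Y \<Longrightarrow> 0 < e \<Longrightarrow> \<exists>j. N (y - D j) < e"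
  obtains T :: "'a \<Rightarrow> linfty" where "linear T" "\<And>y. y \<in> Y \<Longrightarrow> norm (T y) = N y"
proof -
  have sub: "sublinear N" using add scale by (auto simp: sublinear_def)
  have sym: "N (- x) = N x" for x using scale[of "- 1" x] by simp
  have "\<exists>l. linear l \<and> (\<forall>x. l x \<le> N x) \<and> l (D j) = N (D j)" for j
    using sublinear_support_functional[OF sub, of "D j"] by blast
  then obtain l where l: "\<And>j. linear (l j)" "\<And>j x. l j x \<le> N x" "\<And>j. l j (D j) = N (D j)"
    by metis
  have abs: "\<bar>l j x\<bar> \<le> N x" for j x
    using l(2)[of j x] l(2)[of j "- x"] linear_neg[OF l(1), of j x] sym[of x] by simp
  define T :: "'a \<Rightarrow> linfty" where "T x = Bcontfun (\<lambda>j. l j x)" for x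
  have "(\<lambda>j. l j x) \<in> bcontfun" for x
    using abs by (auto simp: bcontfun_def bounded_iff intro!: exI[of _ "N x"])
  then have T: "apply_bcontfun (T x) j = l j x" for x j
    by (simp add: T_def Bcontfun_inverse)
  have "linear T"
    by (intro linearI bcontfun_eqI) (simp_all add: T linear_add[OF l(1)] linear_scale[OF l(1)])
  moreover have "norm (T y) = N y" if y: "y \<in> Y" for y
  proof (rule antisym)
    show "norm (T y) \<le> N y" using abs by (intro norm_bound) (simp add: T)
    show "N y \<le> norm (T y)"
    proof (rule field_le_epsilon)
      fix e :: real assume "0 < e"
      \<comment> \<open>Coordinate \<open>j\<close> is exact at \<open>D j\<close>. Replacing
        \<open>y\<close> by \<open>D j\<close> costs at most \<open>N (y - D j)\<close> twice, once
        in \<open>N\<close> and once in \<open>l j\<close>, hence \<open>e / 2\<close>.\<close>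
      then obtain j where j: "N (y - D j) < e / 2" using dense[OF y, of "e / 2"] by auto
      have "N y \<le> N (y - D j) + N (D j)" using add[of "y - D j" "D j"] by simp
      also have "N (D j) = l j y - l j (y - D j)" by (simp add: l(3) linear_diff[OF l(1)])
      also have "\<dots> \<le> norm (T y) + N (y - D j)"
        using norm_bounded[of "T y" j] abs[of j "y - D j"] by (simp add: T)
      finally show "N y \<le> norm (T y) + e" using j by simp
    qed
  qed
  ultimately show thesis by (rule that)
qed

section \<open>Limits, gauges and extensions\<close>

text \<open>By Tychonoff the functions \<open>M n\<close> lie in a compact product of intervals and
  so have a cluster point. A filter takes the place of a subsequence because convergence is required
  at all \<open>x\<close> simultaneously.\<close>

lemma cluster_filter_exists:
  fixes M :: "nat \<Rightarrow> 'a \<Rightarrow> real"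
  assumes "\<And>n x. 0 \<le> M n x" "\<And>n x. M n x \<le> B x"
  obtains \<F> L where "\<F> \<noteq> bot" "\<F> \<le> sequentially" "\<And>x. ((\<lambda>n. M n x) \<longlongrightarrow> L x) \<F>"
proof -
  define S where "S = PiE UNIV (\<lambda>x. {0..B x})"
  have "compactin (product_topology (\<lambda>_. euclidean) UNIV) S"
    unfolding S_def by (subst compactin_PiE) (auto simp: compactin_euclidean_iff)
  then have "compact S"
    unfolding euclidean_product_topology compactin_euclidean_iff .
  moreover have "M n \<in> S" for n using assms by (simp add: S_def PiE_iff)
  then have "eventually (\<lambda>f. f \<in> S) (filtermap M sequentially)"
    by (simp add: eventually_filtermap)
  moreover have "filtermap M sequentially \<noteq> bot" by (simp add: filtermap_bot_iff)
  ultimately obtain L where L: "inf (nhds L) (filtermap M sequentially) \<noteq> bot"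
    unfolding compact_filter by blast
  \<comment> \<open>Neighbourhoods of the cluster point are pulled back to indices; clustering says
    exactly that they meet every tail.\<close>
  define \<F> where "\<F> = inf (filtercomap M (nhds L)) sequentially"
  have "\<F> \<noteq> bot"
  proof
    assume "\<F> = bot"
    then have "eventually (\<lambda>_. False) \<F>" by simp
    then obtain P Q where "eventually P (filtercomap M (nhds L))" "eventually Q sequentially"
      "\<And>n. P n \<Longrightarrow> Q n \<Longrightarrow> False"
      unfolding \<F>_def eventually_inf by blast
    then obtain R where R: "eventually R (nhds L)" "\<And>n. R (M n) \<Longrightarrow> Q n \<Longrightarrow> False"
      unfolding eventually_filtercomap by blast
    have "eventually (\<lambda>f. \<not> R f) (filtermap M sequentially)"
      unfolding eventually_filtermap using \<open>eventually Q sequentially\<close>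
      by (rule eventually_mono) (use R(2) in blast)
    with R(1) have "eventually (\<lambda>_. False) (inf (nhds L) (filtermap M sequentially))"
      unfolding eventually_inf by blast
    with L show False by (simp add: trivial_limit_def)
  qed
  moreover have "\<F> \<le> sequentially" by (simp add: \<F>_def)
  moreover have "((\<lambda>n. M n x) \<longlongrightarrow> L x) \<F>" for x
  proof -
    have lim: "(M \<longlongrightarrow> L) \<F>"
      using filterlim_filtercomap[of M "nhds L"] unfolding \<F>_def
      by (rule filterlim_mono) auto
    show ?thesis
    proof (rule topological_tendstoI)
      fix W assume W: "open W" "L x \<in> W"
      have "open ((\<lambda>f. f x) -` W)"
        by (rule open_vimage[OF W(1) continuous_on_product_coordinates])
      then have "eventually (\<lambda>n. M n \<in> (\<lambda>f. f x) -` W) \<F>"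
        by (rule topological_tendstoD[OF lim]) (simp add: W(2))
      then show "eventually (\<lambda>n. M n x \<in> W) \<F>" by simp
    qed
  qed
  ultimately show thesis by (rule that)
qed

text \<open>The unit ball of \<open>M\<close> is convex, so its gauge \<open>M powr (1 / p)\<close> is subadditive.\<close>

lemma gauge_triangle:
  fixes M :: "'a::real_vector \<Rightarrow> real"
  assumes p: "0 < p" and nonneg: "\<And>x. 0 \<le> M x"
    and scale: "\<And>c x. M (c *\<^sub>R x) = \<bar>c\<bar> powr p * M x"
    and convex: "\<And>t x y. 0 \<le> t \<Longrightarrow> t \<le> 1 \<Longrightarrow> M ((1 - t) *\<^sub>R x + t *\<^sub>R y) \<le> (1 - t) * M x + t * M y"
  shows "M (x + y) powr (1 / p) \<le> M x powr (1 / p) + M y powr (1 / p)"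
proof (rule field_le_epsilon)
  fix e :: real assume "0 < e"
  have unit: "\<exists>r. 0 < r \<and> r = M z powr (1 / p) + e / 2 \<and> M ((1 / r) *\<^sub>R z) \<le> 1" for z
  proof -
    \<comment> \<open>The extra \<open>e / 2\<close> keeps the scaling factor positive when
      \<open>M z = 0\<close>.\<close>
    define r where "r = M z powr (1 / p) + e / 2"
    have r: "0 < r" using \<open>0 < e\<close> by (simp add: r_def add_nonneg_pos)
    have "M z = (M z powr (1 / p)) powr p" using p nonneg by (simp add: powr_powr)
    also have "\<dots> \<le> r powr p" using p \<open>0 < e\<close> by (intro powr_mono2) (auto simp: r_def)
    finally have "M ((1 / r) *\<^sub>R z) \<le> 1"
      unfolding scale using r by (simp add: powr_divide)
    with r show ?thesis by (auto simp: r_def)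
  qed
  obtain a where a: "0 < a" "a = M x powr (1 / p) + e / 2" "M ((1 / a) *\<^sub>R x) \<le> 1"
    using unit by blast
  obtain b where b: "0 < b" "b = M y powr (1 / p) + e / 2" "M ((1 / b) *\<^sub>R y) \<le> 1"
    using unit by blast
  define t where "t = b / (a + b)"
  have t: "0 \<le> t" "t \<le> 1" "1 - t = a / (a + b)" using a b by (auto simp: t_def field_simps)
  have "(1 / (a + b)) *\<^sub>R (x + y) = (1 - t) *\<^sub>R ((1 / a) *\<^sub>R x) + t *\<^sub>R ((1 / b) *\<^sub>R y)"
    using a(1) b(1) unfolding t(3) by (simp add: t_def scaleR_add_right)
  then have "M ((1 / (a + b)) *\<^sub>R (x + y)) \<le> (1 - t) * M ((1 / a) *\<^sub>R x) + t * M ((1 / b) *\<^sub>R y)"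
    using convex[OF t(1,2)] by (simp only:)
  also have "\<dots> \<le> (1 - t) * 1 + t * 1"
    using t a b by (intro add_mono mult_left_mono) auto
  finally have "M (x + y) \<le> (a + b) powr p"
    unfolding scale using a(1) b(1) by (simp add: powr_divide)
  then have "M (x + y) powr (1 / p) \<le> ((a + b) powr p) powr (1 / p)"
    using p nonneg by (intro powr_mono2) auto
  also have "\<dots> = a + b" using p a(1) b(1) by (simp add: powr_powr)
  finally show "M (x + y) powr (1 / p) \<le> M x powr (1 / p) + M y powr (1 / p) + e"
    using a(2) b(2) by simp
qed

section \<open>Separable spans and extension of isometries to closures\<close>

lemma separable_span:
  fixes S :: "'a::real_normed_vector set" and c :: "nat \<Rightarrow> 'a"
  assumes "S \<subseteq> closure (range c)"
  obtains D :: "nat \<Rightarrow> 'a" where "span S \<subseteq> closure (range D)"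
proof -
  \<comment> \<open>Rational combinations are coded by lists of coefficient-index pairs. Such lists
    form a countable type, addition becomes concatenation, and rational scaling acts on the
    entries.\<close>
  define comb :: "(rat \<times> nat) list \<Rightarrow> 'a"
    where "comb xs = (\<Sum>z\<leftarrow>xs. of_rat (fst z) *\<^sub>R c (snd z))" for xs
  define D where "D = comb \<circ> from_nat"
  have range: "range D = range comb"
    unfolding D_def image_comp[symmetric] by simp
  have comb_add: "comb xs + comb ys = comb (xs @ ys)" for xs ys
    by (simp add: comb_def)
  have comb_scale: "of_rat r *\<^sub>R comb xs = comb (map (\<lambda>z. (r * fst z, snd z)) xs)" for r xs
    by (induction xs) (simp_all add: comb_def scaleR_add_right of_rat_mult)
  have "subspace (closure (range comb))"
  proof (rule subspaceI)
    have "comb [] = 0" by (simp add: comb_def)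
    then show "0 \<in> closure (range comb)" using closure_subset by (metis rangeI subsetD)
  next
    fix x y assume xy: "x \<in> closure (range comb)" "y \<in> closure (range comb)"
    show "x + y \<in> closure (range comb)"
      unfolding closure_approachable
    proof (intro allI impI)
      fix e :: real assume "0 < e"
      then have "0 < e / 2" by simp
      then obtain xs ys where "dist (comb xs) x < e / 2" "dist (comb ys) y < e / 2"
        using xy unfolding closure_approachable by blast
      then have "dist (comb xs + comb ys) (x + y) < e"
        by (rule dist_triangle_add_half)
      then show "\<exists>z\<in>range comb. dist z (x + y) < e" unfolding comb_add by auto
    qed
  next
    fix r :: real and x assume x: "x \<in> closure (range comb)"
    show "r *\<^sub>R x \<in> closure (range comb)"
      unfolding closure_approachable
    proof (intro allI impI)
      fix e :: real assume e: "0 < e"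
      have "0 < e / (2 * (\<bar>r\<bar> + 1))" using e by simp
      then obtain xs where xs: "dist (comb xs) x < e / (2 * (\<bar>r\<bar> + 1))"
        using x unfolding closure_approachable by blast
      \<comment> \<open>Two errors of less than \<open>e / 2\<close> each: approximating
        \<open>x\<close> is magnified by the size of \<open>r\<close>, approximating
        \<open>r\<close> by a rational is magnified by \<open>norm (comb xs)\<close>. The added 1
        keeps the denominators positive.\<close>
      define \<delta> where "\<delta> = e / (2 * (norm (comb xs) + 1))"
      have "0 < \<delta>" using e by (simp add: \<delta>_def add_nonneg_pos)
      then obtain s where s: "r < of_rat s" "of_rat s < r + \<delta>" using of_rat_dense[of r "r + \<delta>"] by auto
      have "dist (of_rat s *\<^sub>R comb xs) (r *\<^sub>R x)
          = norm ((of_rat s - r) *\<^sub>R comb xs + r *\<^sub>R (comb xs - x))"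
        by (simp add: dist_norm algebra_simps)
      also have "\<dots> \<le> \<bar>of_rat s - r\<bar> * norm (comb xs) + \<bar>r\<bar> * norm (comb xs - x)"
        by (rule norm_triangle_le) simp
      finally have *: "dist (of_rat s *\<^sub>R comb xs) (r *\<^sub>R x)
          \<le> \<bar>of_rat s - r\<bar> * norm (comb xs) + \<bar>r\<bar> * norm (comb xs - x)" .
      have half: "e / (2 * (b + 1)) * b < e / 2" if "0 \<le> b" for b
        using that e by (simp add: divide_simps)
      have "\<bar>of_rat s - r\<bar> * norm (comb xs) \<le> \<delta> * norm (comb xs)"
        using s by (intro mult_right_mono) auto
      also have "\<dots> < e / 2" unfolding \<delta>_def by (rule half) simp
      finally have 1: "\<bar>of_rat s - r\<bar> * norm (comb xs) < e / 2" .
      have "norm (comb xs - x) * \<bar>r\<bar> \<le> e / (2 * (\<bar>r\<bar> + 1)) * \<bar>r\<bar>"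
        using xs by (intro mult_right_mono) (auto simp: dist_norm)
      also have "\<dots> < e / 2" by (rule half) simp
      finally have 2: "\<bar>r\<bar> * norm (comb xs - x) < e / 2" by (simp add: mult.commute)
      from * 1 2 have "dist (of_rat s *\<^sub>R comb xs) (r *\<^sub>R x) < e" by linarith
      then show "\<exists>y\<in>range comb. dist y (r *\<^sub>R x) < e" unfolding comb_scale by blast
    qed
  qed
  moreover have "S \<subseteq> closure (range comb)"
  proof -
    have "c i = comb [(1, i)]" for i unfolding comb_def by simp
    then have "range c \<subseteq> range comb" by (intro image_subsetI image_eqI[OF _ UNIV_I])
    from assms closure_mono[OF this] show ?thesis by (rule subset_trans)
  qed
  ultimately have "span S \<subseteq> closure (range D)"
    unfolding range by (intro span_minimal)
  then show thesis by (rule that)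
qed

lemma subspace_closure:
  assumes "subspace (W :: 'a::real_normed_vector set)"
  shows "subspace (closure W)"
proof (rule subspaceI)
  show "0 \<in> closure W" using subspace_0[OF assms] closure_subset by (rule subsetD[rotated])
next
  fix x y assume "x \<in> closure W" "y \<in> closure W"
  then obtain u v where u: "\<forall>n. u n \<in> W" "u \<longlonglongrightarrow> x" and v: "\<forall>n. v n \<in> W" "v \<longlonglongrightarrow> y"
    unfolding closure_sequential by auto
  have "u n + v n \<in> W" for n using u(1) v(1) by (simp add: subspace_add[OF assms])
  with tendsto_add[OF u(2) v(2)] show "x + y \<in> closure W"
    unfolding closure_sequential by (intro exI[of _ "\<lambda>n. u n + v n"]) simp
next
  fix c :: real and x assume "x \<in> closure W"
  then obtain u where u: "\<forall>n. u n \<in> W" "u \<longlonglongrightarrow> x"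
    unfolding closure_sequential by auto
  have "c *\<^sub>R u n \<in> W" for n using u(1) by (simp add: subspace_scale[OF assms])
  with tendsto_scaleR[OF tendsto_const u(2), of c] show "c *\<^sub>R x \<in> closure W"
    unfolding closure_sequential by (intro exI[of _ "\<lambda>n. c *\<^sub>R u n"]) simp
qed

lemma bcontfun_Cauchy_convergent:
  fixes f :: "nat \<Rightarrow> 'x::topological_space \<Rightarrow>\<^sub>C 'y::complete_space"
  assumes "Cauchy f"
  shows "convergent f"
proof -
  have "uniformly_Cauchy_on UNIV (\<lambda>n. apply_bcontfun (f n))"
    unfolding uniformly_Cauchy_on_def
  proof (intro allI impI)
    fix e :: real assume "0 < e"
    then obtain n0 where "\<forall>m\<ge>n0. \<forall>n\<ge>n0. dist (f m) (f n) < e"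
      using assms unfolding Cauchy_def by blast
    then show "\<exists>n0. \<forall>x\<in>UNIV. \<forall>m\<ge>n0. \<forall>n\<ge>n0. dist (apply_bcontfun (f m) x) (apply_bcontfun (f n) x) < e"
      by (intro exI[of _ n0]) (simp add: dist_fun_lt_imp_dist_val_lt)
  qed
  then obtain l where "uniform_limit UNIV (\<lambda>n. apply_bcontfun (f n)) l sequentially"
    using Cauchy_uniformly_convergent unfolding uniformly_convergent_on_def by blast
  then obtain l' where "f \<longlonglongrightarrow> l'"
    by (rule uniform_limit_bcontfunE[OF _ sequentially_bot])
  then show ?thesis by (rule convergentI)
qed

text \<open>\<open>T\<close> may have a kernel, so \<pi> is not obtained by inverting it. It is
  defined by limits along sequences in \<open>Y\<close>, and \<open>iso\<close> makes these limits
  exist and depend only on the vector approximated. Bijectivity comes from the inverse group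
  element.\<close>

lemma isometric_representation_on_closure:
  fixes T :: "'a::real_vector \<Rightarrow> 'v::real_normed_vector" and \<rho> :: "'g::group_add \<Rightarrow> 'a \<Rightarrow> 'a"
  assumes complete: "\<And>X :: nat \<Rightarrow> 'v. Cauchy X \<Longrightarrow> convergent X"
    and T: "linear T" and Y: "subspace Y"
    and \<rho>: "\<And>g. linear (\<rho> g)" "\<And>g y. y \<in> Y \<Longrightarrow> \<rho> g y \<in> Y" "\<And>y. \<rho> 0 y = y"
      "\<And>g h y. \<rho> (g + h) y = \<rho> g (\<rho> h y)"
    and iso: "\<And>g y. y \<in> Y \<Longrightarrow> norm (T (\<rho> g y)) = norm (T y)"
  obtains \<pi> where "isometric_representation_on (closure (T ` Y)) \<pi>"
    "\<And>g y. y \<in> Y \<Longrightarrow> \<pi> g (T y) = T (\<rho> g y)"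
proof -
  define V where "V = closure (T ` Y)"
  have "\<exists>s. (\<forall>k. s k \<in> Y) \<and> (\<lambda>k. T (s k)) \<longlonglongrightarrow> v" if v: "v \<in> V" for v
  proof -
    have "\<exists>w. (\<forall>k. w k \<in> T ` Y) \<and> w \<longlonglongrightarrow> v"
      using v unfolding V_def by (simp only: closure_sequential)
    then obtain w where w: "(\<forall>k. w k \<in> T ` Y) \<and> w \<longlonglongrightarrow> v" by (rule exE)
    define s where "s k = (SOME y. y \<in> Y \<and> T y = w k)" for k
    have s: "s k \<in> Y \<and> T (s k) = w k" for k
    proof -
      have "w k \<in> T ` Y" using w by (rule conjunct1[THEN spec])
      then obtain y where "w k = T y" "y \<in> Y" by (rule imageE)
      then have "y \<in> Y \<and> T y = w k" by simp
      then show ?thesis unfolding s_def by (rule someI)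
    qed
    show ?thesis using w s by (intro exI[of _ s]) simp
  qed
  then have *: "\<forall>v\<in>V. \<exists>s. (\<forall>k. s k \<in> Y) \<and> (\<lambda>k. T (s k)) \<longlonglongrightarrow> v" by blast
  have VI: "v \<in> V" if "\<And>k. y k \<in> Y" "(\<lambda>k. T (y k)) \<longlonglongrightarrow> v" for y v
    unfolding V_def closure_sequential by (intro exI[of _ "\<lambda>k. T (y k)"] conjI allI imageI that)
  from bchoice[OF *] obtain s
    where s': "\<forall>v\<in>V. (\<forall>k. s v k \<in> Y) \<and> (\<lambda>k. T (s v k)) \<longlonglongrightarrow> v" by blast
  have s: "s v k \<in> Y" "(\<lambda>k. T (s v k)) \<longlonglongrightarrow> v" if "v \<in> V" for v k
    using s' that by simp_all
  define \<pi> where "\<pi> g v = lim (\<lambda>k. T (\<rho> g (s v k)))" for g v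
  have diff: "norm (T (\<rho> g x) - T (\<rho> g y)) = norm (T x - T y)" if "x \<in> Y" "y \<in> Y" for g x y
    using iso[OF subspace_diff[OF Y that], of g] by (simp add: linear_diff[OF T] linear_diff[OF \<rho>(1)])
  \<comment> \<open>Independence of the approximating sequence. Every algebraic property of \<pi>
    follows by feeding in a convenient sequence and comparing limits.\<close>
  have lim: "(\<lambda>k. T (\<rho> g (y k))) \<longlonglongrightarrow> \<pi> g v" if v: "v \<in> V" and y: "\<And>k. y k \<in> Y" "(\<lambda>k. T (y k)) \<longlonglongrightarrow> v" for g v y
  proof -
    have "Cauchy (\<lambda>k. T (s v k))" using s(2)[OF v] by (rule LIMSEQ_imp_Cauchy)
    then have "Cauchy (\<lambda>k. T (\<rho> g (s v k)))"
      by (simp add: Cauchy_def dist_norm diff s(1)[OF v])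
    then have *: "(\<lambda>k. T (\<rho> g (s v k))) \<longlonglongrightarrow> \<pi> g v"
      unfolding \<pi>_def by (rule convergent_LIMSEQ_iff[THEN iffD1, OF complete])
    have "(\<lambda>k. norm (T (y k) - T (s v k))) \<longlonglongrightarrow> norm (v - v)"
      by (intro tendsto_norm tendsto_diff y(2) s(2)[OF v])
    then have "(\<lambda>k. norm (T (\<rho> g (y k)) - T (\<rho> g (s v k)))) \<longlonglongrightarrow> 0"
      by (simp add: diff y(1) s(1)[OF v])
    from tendsto_add[OF tendsto_norm_zero_cancel[OF this] *] show ?thesis by simp
  qed
  have TY: "T y \<in> V" if "y \<in> Y" for y
    by (rule VI[of "\<lambda>_. y"]) (use that in auto)
  have \<pi>_T: "\<pi> g (T y) = T (\<rho> g y)" if "y \<in> Y" for g y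
    using lim[OF TY[OF that], of "\<lambda>_. y" g] that by (simp add: LIMSEQ_const_iff)
  have \<pi>_V: "\<pi> g v \<in> V" if "v \<in> V" for g v
  proof -
    have "closed V" by (simp add: V_def)
    moreover have "T (\<rho> g (s v k)) \<in> V" for k by (intro TY \<rho>(2) s(1) that)
    ultimately show ?thesis
      by (rule closed_sequentially[OF _ _ lim[OF that s[OF that], of g]])
  qed
  have \<pi>_add: "\<pi> g (v + w) = \<pi> g v + \<pi> g w" and V_add: "v + w \<in> V" if "v \<in> V" "w \<in> V" for g v w
  proof -
    have sum: "(\<lambda>k. T (s v k + s w k)) \<longlonglongrightarrow> v + w"
      unfolding linear_add[OF T] by (intro tendsto_add s that)
    have Y': "s v k + s w k \<in> Y" for k by (intro subspace_add[OF Y] s that)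
    then show vw: "v + w \<in> V"
      by (rule VI[OF _ sum])
    have "(\<lambda>k. T (\<rho> g (s v k + s w k))) \<longlonglongrightarrow> \<pi> g v + \<pi> g w"
      unfolding linear_add[OF T] linear_add[OF \<rho>(1)] by (intro tendsto_add lim s that)
    then show "\<pi> g (v + w) = \<pi> g v + \<pi> g w"
      using lim[OF vw Y' sum, of g] by (rule LIMSEQ_unique[rotated])
  qed
  have \<pi>_scale: "\<pi> g (c *\<^sub>R v) = c *\<^sub>R \<pi> g v" if "v \<in> V" for g c v
  proof -
    have sc: "(\<lambda>k. T (c *\<^sub>R s v k)) \<longlonglongrightarrow> c *\<^sub>R v"
      unfolding linear_scale[OF T] by (intro tendsto_scaleR tendsto_const s that)
    have Y': "c *\<^sub>R s v k \<in> Y" for k by (intro subspace_scale[OF Y] s that)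
    then have cv: "c *\<^sub>R v \<in> V"
      by (rule VI[OF _ sc])
    have "(\<lambda>k. T (\<rho> g (c *\<^sub>R s v k))) \<longlonglongrightarrow> c *\<^sub>R \<pi> g v"
      unfolding linear_scale[OF T] linear_scale[OF \<rho>(1)] by (intro tendsto_scaleR tendsto_const lim s that)
    then show ?thesis using lim[OF cv Y' sc, of g] by (rule LIMSEQ_unique[rotated])
  qed
  have \<pi>_norm: "norm (\<pi> g v) = norm v" if "v \<in> V" for g v
  proof -
    have "(\<lambda>k. norm (T (s v k))) \<longlonglongrightarrow> norm (\<pi> g v)"
      using tendsto_norm[OF lim[OF that s[OF that], of g]] by (simp add: iso s(1)[OF that])
    then show ?thesis using tendsto_norm[OF s(2)[OF that]] by (rule LIMSEQ_unique)
  qed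
  have \<pi>_zero: "\<pi> 0 v = v" if "v \<in> V" for v
    using lim[OF that s[OF that], of 0] s(2)[OF that] unfolding \<rho>(3) by (rule LIMSEQ_unique)
  have \<pi>_plus: "\<pi> (g + h) v = \<pi> g (\<pi> h v)" if "v \<in> V" for g h v
  proof -
    have "(\<lambda>k. T (\<rho> (g + h) (s v k))) \<longlonglongrightarrow> \<pi> g (\<pi> h v)"
      unfolding \<rho>(4)
      by (rule lim[OF \<pi>_V[OF that] _ lim[OF that s[OF that], of h]]) (intro \<rho>(2) s that)
    then show ?thesis using lim[OF that s[OF that], of "g + h"] by (rule LIMSEQ_unique[rotated])
  qed
  have inv: "\<pi> g (\<pi> (- g) v) = v" "\<pi> (- g) (\<pi> g v) = v" if "v \<in> V" for g v
    using \<pi>_plus[OF that, of g "- g"] \<pi>_plus[OF that, of "- g" g] \<pi>_zero[OF that] by simp_all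
  have "isometric_representation_on V \<pi>"
    unfolding isometric_representation_on_def invertible_linear_isometry_on_def
  proof (intro conjI allI ballI)
    show "bij_betw (\<pi> g) V V" for g
      by (rule bij_betw_byWitness[where f' = "\<pi> (- g)"]) (use inv \<pi>_V in auto)
  qed (use \<pi>_add \<pi>_scale \<pi>_norm \<pi>_zero \<pi>_plus in auto)
  then show thesis using \<pi>_T unfolding V_def by (rule that)
qed

section \<open>Norms as limits of averages\<close>

lemma apply_bcontfun_sum:
  "apply_bcontfun (\<Sum>i\<in>I. f i) x = (\<Sum>i\<in>I. apply_bcontfun (f i :: 'x::topological_space \<Rightarrow>\<^sub>C 'e::real_normed_vector) x)"
  by (induction I rule: infinite_finite_induct) simp_all

text \<open>\<open>M\<close> is the p-th power of the seminorm: scaling, convexity and the passage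
  to the limit are simplest before the root is taken.\<close>

locale averaged_norm =
  fixes \<F> :: "nat filter" and A :: "nat \<Rightarrow> 'x::topological_space set" and p :: real
    and M :: "('x \<Rightarrow>\<^sub>C 'e::real_normed_vector) \<Rightarrow> real"
  assumes nontrivial: "\<F> \<noteq> bot" and finite_A: "finite (A n)" and A_nonempty: "A n \<noteq> {}" and p: "1 \<le> p"
    and lim: "((\<lambda>n. avg (A n) (\<lambda>a. norm (apply_bcontfun F a) powr p)) \<longlongrightarrow> M F) \<F>"
begin

definition N :: "('x \<Rightarrow>\<^sub>C 'e) \<Rightarrow> real" where
  "N F = M F powr (1 / p)"

lemma M_nonneg: "0 \<le> M F"
  by (rule tendsto_lowerbound[OF lim _ nontrivial]) (simp add: avg_nonneg)

lemma N_powr: "N F powr r = M F powr (r / p)"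
  by (simp add: N_def powr_powr)

lemma N_powr_p: "N F powr p = M F"
  using p M_nonneg by (simp add: N_powr)

lemma M_scale: "M (c *\<^sub>R F) = \<bar>c\<bar> powr p * M F"
proof -
  have "(\<lambda>n. avg (A n) (\<lambda>a. norm (apply_bcontfun (c *\<^sub>R F) a) powr p))
      = (\<lambda>n. \<bar>c\<bar> powr p * avg (A n) (\<lambda>a. norm (apply_bcontfun F a) powr p))"
    by (simp add: powr_mult flip: avg_cmult)
  then show ?thesis
    using tendsto_unique[OF nontrivial lim[of "c *\<^sub>R F"]] tendsto_mult_left[OF lim[of F]] by metis
qed

lemma M_convex:
  assumes "0 \<le> t" "t \<le> 1"
  shows "M ((1 - t) *\<^sub>R F + t *\<^sub>R G) \<le> (1 - t) * M F + t * M G"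
proof (rule tendsto_le[OF nontrivial _ lim])
  show "((\<lambda>n. (1 - t) * avg (A n) (\<lambda>a. norm (apply_bcontfun F a) powr p)
      + t * avg (A n) (\<lambda>a. norm (apply_bcontfun G a) powr p)) \<longlongrightarrow> (1 - t) * M F + t * M G) \<F>"
    by (intro tendsto_add tendsto_mult_left lim)
  have pointwise: "norm ((1 - t) *\<^sub>R u + t *\<^sub>R v) powr p \<le> (1 - t) * norm u powr p + t * norm v powr p"
    for u v :: 'e
  proof -
    have "norm ((1 - t) *\<^sub>R u + t *\<^sub>R v) \<le> (1 - t) * norm u + t * norm v"
      by (rule norm_triangle_le) (use assms in simp)
    then have "norm ((1 - t) *\<^sub>R u + t *\<^sub>R v) powr p \<le> ((1 - t) * norm u + t * norm v) powr p"
      using p by (intro powr_mono2) auto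
    also have "\<dots> \<le> (1 - t) * norm u powr p + t * norm v powr p"
      using convex_onD[OF powr_convex_nonneg[OF p] assms, of "norm u" "norm v"] by simp
    finally show ?thesis .
  qed
  show "eventually (\<lambda>n. avg (A n) (\<lambda>a. norm (apply_bcontfun ((1 - t) *\<^sub>R F + t *\<^sub>R G) a) powr p)
      \<le> (1 - t) * avg (A n) (\<lambda>a. norm (apply_bcontfun F a) powr p)
        + t * avg (A n) (\<lambda>a. norm (apply_bcontfun G a) powr p)) \<F>"
    unfolding avg_cmult[symmetric] avg_add[symmetric]
    by (intro always_eventually allI avg_mono) (simp add: pointwise)
qed

lemma N_triangle: "N (F + G) \<le> N F + N G"
  unfolding N_def by (rule gauge_triangle) (use p M_nonneg M_scale M_convex in auto)

lemma N_scale: "N (c *\<^sub>R F) = \<bar>c\<bar> * N F"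
  using p by (simp add: N_def M_scale powr_mult powr_powr)

lemma N_le:
  assumes "\<And>x. norm (apply_bcontfun F x) \<le> B" "0 \<le> B"
  shows "N F \<le> B"
proof -
  have "M F \<le> B powr p"
  proof (rule tendsto_upperbound[OF lim _ nontrivial])
    have "avg (A n) (\<lambda>a. norm (apply_bcontfun F a) powr p) \<le> avg (A n) (\<lambda>a. B powr p)" for n
      using p assms by (intro avg_mono powr_mono2) auto
    then show "eventually (\<lambda>n. avg (A n) (\<lambda>a. norm (apply_bcontfun F a) powr p) \<le> B powr p) \<F>"
      by (simp add: avg_const[OF finite_A A_nonempty])
  qed
  then have "N F \<le> (B powr p) powr (1 / p)"
    unfolding N_def using p M_nonneg by (intro powr_mono2) auto
  then show ?thesis using p assms(2) by (simp add: powr_powr)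
qed

lemma N_ge:
  assumes "\<And>x. B \<le> norm (apply_bcontfun F x)" "0 \<le> B"
  shows "B \<le> N F"
proof -
  have "B powr p \<le> M F"
  proof (rule tendsto_lowerbound[OF lim _ nontrivial])
    have "avg (A n) (\<lambda>a. B powr p) \<le> avg (A n) (\<lambda>a. norm (apply_bcontfun F a) powr p)" for n
      using p assms by (intro avg_mono powr_mono2) auto
    then show "eventually (\<lambda>n. B powr p \<le> avg (A n) (\<lambda>a. norm (apply_bcontfun F a) powr p)) \<F>"
      by (simp add: avg_const[OF finite_A A_nonempty])
  qed
  then have "(B powr p) powr (1 / p) \<le> N F"
    unfolding N_def using p by (intro powr_mono2) auto
  then show ?thesis using p assms(2) by (simp add: powr_powr)
qed

lemma N_le_norm: "N F \<le> norm F"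
  by (rule N_le) (simp_all add: norm_bounded)

text \<open>Applied with \<open>r = 1\<close> for type and \<open>r = q / p\<close> for
  cotype.\<close>

lemma lim_powr_sum:
  assumes "0 < r"
  shows "((\<lambda>k. avg S (\<lambda>\<epsilon>. avg (A k) (\<lambda>a. norm (\<Sum>i<n. \<epsilon> i *\<^sub>R apply_bcontfun (f i) a) powr p) powr r))
    \<longlongrightarrow> avg S (\<lambda>\<epsilon>. M (\<Sum>i<n. \<epsilon> i *\<^sub>R f i) powr r)) \<F>"
proof -
  have "((\<lambda>k. avg (A k) (\<lambda>a. norm (\<Sum>i<n. \<epsilon> i *\<^sub>R apply_bcontfun (f i) a) powr p) powr r)
      \<longlongrightarrow> M (\<Sum>i<n. \<epsilon> i *\<^sub>R f i) powr r) \<F>" for \<epsilon>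
    using lim[of "\<Sum>i<n. \<epsilon> i *\<^sub>R f i"] assms
    by (intro tendsto_powr2 tendsto_const) (simp_all add: apply_bcontfun_sum avg_nonneg)
  then show ?thesis
    unfolding avg_def[of S] divide_inverse by (intro tendsto_mult_right tendsto_sum)
qed

lemma N_type:
  assumes "has_type (UNIV :: 'e set) p"
  shows "\<exists>C\<ge>0. \<forall>n f. avg (signs n) (\<lambda>\<epsilon>. N (\<Sum>i<n. \<epsilon> i *\<^sub>R f i) powr p) \<le> C * (\<Sum>i<n. N (f i) powr p)"
proof -
  have p0: "0 < p" using p by simp
  obtain C where C: "0 \<le> C" "\<And>n B (f :: nat \<Rightarrow> 'x \<Rightarrow> 'e).
      avg (signs n) (\<lambda>\<epsilon>. avg B (\<lambda>a. norm (\<Sum>i<n. \<epsilon> i *\<^sub>R f i a) powr p))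
        \<le> C * (\<Sum>i<n. avg B (\<lambda>a. norm (f i a) powr p))"
    by (rule has_type_avg[OF assms p0]) (rule that)
  have "avg (signs n) (\<lambda>\<epsilon>. M (\<Sum>i<n. \<epsilon> i *\<^sub>R f i)) \<le> C * (\<Sum>i<n. M (f i))" for n f
  proof (rule tendsto_le[OF nontrivial])
    show "((\<lambda>k. C * (\<Sum>i<n. avg (A k) (\<lambda>a. norm (apply_bcontfun (f i) a) powr p))) \<longlongrightarrow> C * (\<Sum>i<n. M (f i))) \<F>"
      by (intro tendsto_mult_left tendsto_sum lim)
    show "((\<lambda>k. avg (signs n) (\<lambda>\<epsilon>. avg (A k) (\<lambda>a. norm (\<Sum>i<n. \<epsilon> i *\<^sub>R apply_bcontfun (f i) a) powr p)))
        \<longlongrightarrow> avg (signs n) (\<lambda>\<epsilon>. M (\<Sum>i<n. \<epsilon> i *\<^sub>R f i))) \<F>"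
      using lim_powr_sum[where r = 1 and S = "signs n" and n = n and f = f] by (simp add: avg_nonneg M_nonneg)
  qed (intro always_eventually allI C(2))
  then show ?thesis unfolding N_powr_p using C(1) by blast
qed

lemma N_cotype:
  assumes "has_finite_cotype (UNIV :: 'e set) q" "p \<le> q"
  shows "\<exists>C\<ge>0. \<forall>n f. (\<Sum>i<n. N (f i) powr q) \<le> C * avg (signs n) (\<lambda>\<epsilon>. N (\<Sum>i<n. \<epsilon> i *\<^sub>R f i) powr q)"
proof -
  have q: "0 < q / p" using p assms(2) by simp
  obtain C where C: "0 \<le> C" "\<And>n B (f :: nat \<Rightarrow> 'x \<Rightarrow> 'e). finite B \<Longrightarrow> B \<noteq> {} \<Longrightarrow>
      (\<Sum>i<n. avg B (\<lambda>a. norm (f i a) powr p) powr (q / p))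
        \<le> C * avg (signs n) (\<lambda>\<epsilon>. avg B (\<lambda>a. norm (\<Sum>i<n. \<epsilon> i *\<^sub>R f i a) powr p) powr (q / p))"
    by (rule has_finite_cotype_avg[OF assms(1) p assms(2)]) (rule that)
  have "(\<Sum>i<n. M (f i) powr (q / p)) \<le> C * avg (signs n) (\<lambda>\<epsilon>. M (\<Sum>i<n. \<epsilon> i *\<^sub>R f i) powr (q / p))" for n f
  proof (rule tendsto_le[OF nontrivial])
    show "((\<lambda>k. \<Sum>i<n. avg (A k) (\<lambda>a. norm (apply_bcontfun (f i) a) powr p) powr (q / p))
        \<longlongrightarrow> (\<Sum>i<n. M (f i) powr (q / p))) \<F>"
      by (intro tendsto_sum tendsto_powr2 lim tendsto_const always_eventually allI avg_nonneg q) simp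
    show "((\<lambda>k. C * avg (signs n) (\<lambda>\<epsilon>. avg (A k) (\<lambda>a. norm (\<Sum>i<n. \<epsilon> i *\<^sub>R apply_bcontfun (f i) a) powr p) powr (q / p)))
        \<longlongrightarrow> C * avg (signs n) (\<lambda>\<epsilon>. M (\<Sum>i<n. \<epsilon> i *\<^sub>R f i) powr (q / p))) \<F>"
      by (rule tendsto_mult_left[OF lim_powr_sum[OF q]])
  qed (intro always_eventually allI C(2) finite_A A_nonempty)
  then show ?thesis unfolding N_powr using C(1) by blast
qed

end

section \<open>Translations\<close>

text \<open>Right translation is a homomorphism in \<open>g\<close>. Since \<open>x + g\<close> and
  \<open>x + h\<close> are at distance \<open>mdist d g h\<close> for every \<open>x\<close>, it is
  moreover continuous in \<open>g\<close>, in supremum norm, on left uniformly continuous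
  functions.\<close>

definition translate :: "'g::topological_group_add \<Rightarrow> ('g \<Rightarrow>\<^sub>C 'e::real_normed_vector) \<Rightarrow> ('g \<Rightarrow>\<^sub>C 'e)" where
  "translate g F = Bcontfun (\<lambda>x. apply_bcontfun F (x + g))"

lemma apply_translate [simp]: "apply_bcontfun (translate g F) x = apply_bcontfun F (x + g)"
proof -
  have "continuous_on UNIV (\<lambda>x. x + g)"
    unfolding continuous_on_def by (intro ballI tendsto_intros)
  then have "continuous_on UNIV (\<lambda>x. apply_bcontfun F (x + g))"
    by (intro continuous_on_compose2[OF continuous_on_apply_bcontfun[of UNIV]]) auto
  moreover have "bounded (range (\<lambda>x. apply_bcontfun F (x + g)))"
    by (rule bounded_subset[OF bounded_apply_bcontfun[of F]]) auto
  ultimately show ?thesis by (simp add: translate_def Bcontfun_inverse bcontfun_def)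
qed

lemma linear_translate: "linear (translate g)"
  by (intro linearI bcontfun_eqI) simp_all

lemma translate_zero: "translate 0 F = F"
  by (intro bcontfun_eqI) simp

lemma translate_plus: "translate (g + h) F = translate g (translate h F)"
  by (intro bcontfun_eqI) (simp add: add.assoc)

lemma translate_diff_bound:
  assumes d: "compatible_left_invariant_metric d"
    and F: "\<And>x y. mdist d x y < \<delta> \<Longrightarrow> norm (apply_bcontfun F x - apply_bcontfun F y) \<le> e" and "0 \<le> e"
    and gh: "mdist d g h < \<delta>"
  shows "norm (translate g F - translate h F) \<le> e"
proof (rule norm_bound)
  fix x
  have "mdist d (x + g) (x + h) = mdist d g h"
    using d unfolding compatible_left_invariant_metric_def by blast
  then show "norm (apply_bcontfun (translate g F - translate h F) x) \<le> e"
    using F gh by simp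
qed

text \<open>The metric need not be right invariant, but translating both points by a fixed
  \<open>g\<close> conjugates \<open>- x + y\<close> by \<open>g\<close>, and conjugation is
  continuous at 0. The modulus depends on \<open>g\<close>.\<close>

lemma right_translation_uniformly_continuous:
  fixes d :: "'g::topological_group_add metric"
  assumes d: "compatible_left_invariant_metric d" and "0 < \<delta>"
  shows "\<exists>\<delta>'>0. \<forall>x y. mdist d x y < \<delta>' \<longrightarrow> mdist d (x + g) (y + g) < \<delta>"
proof -
  define U where "U = (\<lambda>z. - g + z + g) -` {y. mdist d 0 y < \<delta>}"
  have "continuous_on UNIV (\<lambda>z. - g + z + g)"
    unfolding continuous_on_def by (intro ballI tendsto_intros)
  then have "open U"
    unfolding U_def by (intro open_vimage compatible_metric_open_ball[OF d])
  moreover have "mdist d 0 0 = 0"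
    using d mdist_zero[of 0 d 0] by (simp add: compatible_left_invariant_metric_def)
  then have "0 \<in> U" using \<open>0 < \<delta>\<close> by (simp add: U_def)
  ultimately obtain \<delta>' where \<delta>': "0 < \<delta>'" "\<And>z. mdist d 0 z < \<delta>' \<Longrightarrow> z \<in> U"
    using compatible_metric_ball_subset[OF d] by blast
  have "mdist d (x + g) (y + g) < \<delta>" if "mdist d x y < \<delta>'" for x y
  proof -
    have "- x + y \<in> U" using \<delta>'(2) that left_invariant_mdist_eq[OF d, of x y] by simp
    then have "mdist d 0 (- g + (- x + y) + g) < \<delta>" by (simp add: U_def)
    moreover have "- (x + g) + (y + g) = - g + (- x + y) + g"
      by (simp add: add.assoc minus_add diff_conv_add_uminus del: add_uminus_conv_diff)
    ultimately show ?thesis using left_invariant_mdist_eq[OF d, of "x + g" "y + g"] by simp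
  qed
  with \<delta>'(1) show ?thesis by blast
qed

definition left_uniformly_continuous ::
    "'g metric \<Rightarrow> ('g::topological_space \<Rightarrow>\<^sub>C 'e::real_normed_vector) \<Rightarrow> bool" where
  "left_uniformly_continuous d F \<longleftrightarrow>
    (\<forall>e>0. \<exists>\<delta>>0. \<forall>x y. mdist d x y < \<delta> \<longrightarrow> norm (apply_bcontfun F x - apply_bcontfun F y) \<le> e)"

lemma left_uniformly_continuous_translate:
  assumes d: "compatible_left_invariant_metric d" and F: "left_uniformly_continuous d F"
  shows "left_uniformly_continuous d (translate g F)"
  unfolding left_uniformly_continuous_def
proof (intro allI impI)
  fix e :: real assume "0 < e"
  then obtain \<delta> where \<delta>: "0 < \<delta>"
    "\<forall>x y. mdist d x y < \<delta> \<longrightarrow> norm (apply_bcontfun F x - apply_bcontfun F y) \<le> e"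
    using F unfolding left_uniformly_continuous_def by blast
  obtain \<delta>' where \<delta>': "0 < \<delta>'" "\<forall>x y. mdist d x y < \<delta>' \<longrightarrow> mdist d (x + g) (y + g) < \<delta>"
    using right_translation_uniformly_continuous[OF d \<delta>(1)] by blast
  show "\<exists>\<delta>>0. \<forall>x y. mdist d x y < \<delta> \<longrightarrow>
      norm (apply_bcontfun (translate g F) x - apply_bcontfun (translate g F) y) \<le> e"
    using \<delta>(2) \<delta>' by (intro exI[of _ \<delta>']) simp
qed

lemma subspace_left_uniformly_continuous: "subspace (Collect (left_uniformly_continuous d))"
proof (rule subspaceI)
  show "0 \<in> Collect (left_uniformly_continuous d)"
    by (auto simp: left_uniformly_continuous_def intro: exI[of _ 1])
next
  fix F G :: "'a \<Rightarrow>\<^sub>C 'b"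
  assume FG: "F \<in> Collect (left_uniformly_continuous d)" "G \<in> Collect (left_uniformly_continuous d)"
  show "F + G \<in> Collect (left_uniformly_continuous d)"
    unfolding mem_Collect_eq left_uniformly_continuous_def
  proof (intro allI impI)
    fix e :: real
    have F: "\<forall>e>0. \<exists>\<delta>>0. \<forall>x y. mdist d x y < \<delta> \<longrightarrow> norm (apply_bcontfun F x - apply_bcontfun F y) \<le> e"
      and G: "\<forall>e>0. \<exists>\<delta>>0. \<forall>x y. mdist d x y < \<delta> \<longrightarrow> norm (apply_bcontfun G x - apply_bcontfun G y) \<le> e"
      using FG unfolding left_uniformly_continuous_def by blast+
    assume "0 < e"
    then have "0 < e / 2" by simp
    obtain \<delta> where \<delta>: "0 < \<delta>"
      "\<forall>x y. mdist d x y < \<delta> \<longrightarrow> norm (apply_bcontfun F x - apply_bcontfun F y) \<le> e / 2"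
      using F \<open>0 < e / 2\<close> by blast
    obtain \<delta>' where \<delta>': "0 < \<delta>'"
      "\<forall>x y. mdist d x y < \<delta>' \<longrightarrow> norm (apply_bcontfun G x - apply_bcontfun G y) \<le> e / 2"
      using G \<open>0 < e / 2\<close> by blast
    have "norm (apply_bcontfun (F + G) x - apply_bcontfun (F + G) y) \<le> e" if "mdist d x y < min \<delta> \<delta>'" for x y
    proof -
      have "norm (apply_bcontfun (F + G) x - apply_bcontfun (F + G) y)
          \<le> norm (apply_bcontfun F x - apply_bcontfun F y) + norm (apply_bcontfun G x - apply_bcontfun G y)"
        using norm_triangle_ineq[of "apply_bcontfun F x - apply_bcontfun F y" "apply_bcontfun G x - apply_bcontfun G y"]
        by (simp add: add_diff_add)
      also have "\<dots> \<le> e / 2 + e / 2" using \<delta>(2) \<delta>'(2) that by (intro add_mono) auto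
      finally show ?thesis by simp
    qed
    then show "\<exists>\<delta>>0. \<forall>x y. mdist d x y < \<delta> \<longrightarrow>
        norm (apply_bcontfun (F + G) x - apply_bcontfun (F + G) y) \<le> e"
      using \<delta>(1) \<delta>'(1) by (intro exI[of _ "min \<delta> \<delta>'"]) simp
  qed
next
  fix c :: real and F :: "'a \<Rightarrow>\<^sub>C 'b"
  assume F': "F \<in> Collect (left_uniformly_continuous d)"
  show "c *\<^sub>R F \<in> Collect (left_uniformly_continuous d)"
    unfolding mem_Collect_eq left_uniformly_continuous_def
  proof (intro allI impI)
    fix e :: real
    have F: "\<forall>e>0. \<exists>\<delta>>0. \<forall>x y. mdist d x y < \<delta> \<longrightarrow> norm (apply_bcontfun F x - apply_bcontfun F y) \<le> e"
      using F' unfolding left_uniformly_continuous_def by blast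
    assume e: "0 < e"
    then have "0 < e / (\<bar>c\<bar> + 1)" by simp
    then obtain \<delta> where \<delta>: "0 < \<delta>"
      "\<forall>x y. mdist d x y < \<delta> \<longrightarrow> norm (apply_bcontfun F x - apply_bcontfun F y) \<le> e / (\<bar>c\<bar> + 1)"
      using F by blast
    have "norm (apply_bcontfun (c *\<^sub>R F) x - apply_bcontfun (c *\<^sub>R F) y) \<le> e" if "mdist d x y < \<delta>" for x y
    proof -
      have "norm (apply_bcontfun (c *\<^sub>R F) x - apply_bcontfun (c *\<^sub>R F) y)
          = \<bar>c\<bar> * norm (apply_bcontfun F x - apply_bcontfun F y)"
        by (simp flip: scaleR_diff_right)
      also have "\<dots> \<le> (\<bar>c\<bar> + 1) * (e / (\<bar>c\<bar> + 1))" using \<delta>(2) that by (intro mult_mono) auto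
      finally show ?thesis by simp
    qed
    then show "\<exists>\<delta>>0. \<forall>x y. mdist d x y < \<delta> \<longrightarrow>
        norm (apply_bcontfun (c *\<^sub>R F) x - apply_bcontfun (c *\<^sub>R F) y) \<le> e"
      using \<delta>(1) by blast
  qed
qed

text \<open>The one-sided estimate is the hypothesis under which sums over a net are almost
  invariant. Norms of values stay in the compact interval up to \<open>norm F\<close>, where the
  p-th power is uniformly continuous.\<close>

lemma powr_norm_uniformly_continuous:
  assumes F: "left_uniformly_continuous d F" and "0 < p" "0 < e"
  shows "\<exists>\<delta>>0. \<forall>x y. mdist d x y < \<delta> \<longrightarrow>
    norm (apply_bcontfun F x) powr p \<le> norm (apply_bcontfun F y) powr p + e"
proof -
  have "uniformly_continuous_on {0..norm F} (\<lambda>t. t powr p)"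
    by (intro compact_uniformly_continuous continuous_on_powr' continuous_intros) (use \<open>0 < p\<close> in auto)
  then obtain \<eta> where \<eta>: "0 < \<eta>"
    "\<forall>t\<in>{0..norm F}. \<forall>s\<in>{0..norm F}. dist s t < \<eta> \<longrightarrow> dist (s powr p) (t powr p) < e"
    using \<open>0 < e\<close> unfolding uniformly_continuous_on_def by blast
  \<comment> \<open>Halving turns the weak inequality of left uniform continuity into the strict one
    needed here.\<close>
  have "0 < \<eta> / 2" using \<eta>(1) by simp
  then obtain \<delta> where \<delta>: "0 < \<delta>"
    "\<forall>x y. mdist d x y < \<delta> \<longrightarrow> norm (apply_bcontfun F x - apply_bcontfun F y) \<le> \<eta> / 2"
    using F unfolding left_uniformly_continuous_def by blast
  have "norm (apply_bcontfun F x) powr p \<le> norm (apply_bcontfun F y) powr p + e" if "mdist d x y < \<delta>" for x y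
  proof -
    have "dist (norm (apply_bcontfun F x)) (norm (apply_bcontfun F y)) \<le> \<eta> / 2"
      using \<delta>(2) that norm_triangle_ineq3[of "apply_bcontfun F x" "apply_bcontfun F y"]
      by (force simp: dist_real_def intro: order_trans)
    then have "dist (norm (apply_bcontfun F x) powr p) (norm (apply_bcontfun F y) powr p) < e"
      using \<eta> norm_bounded[of F] by simp
    then show ?thesis by (simp add: dist_real_def)
  qed
  with \<delta>(1) show ?thesis by blast
qed

text \<open>
  Averages over nets in \<open>K n\<close> at scale \<open>1 / (n + 1)\<close> become invariant under every \<open>K m\<close> in the
  limit, and by uniform continuity under the closure of \<open>\<Union>n. K n\<close>.
\<close>

lemma invariant_averaged_norm_exists:
  fixes d :: "'g::topological_group_add metric" and K :: "nat \<Rightarrow> 'g set" and p :: real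
  assumes d: "compatible_left_invariant_metric d"
    and K: "\<And>n. subgroup_add (K n)" "\<And>n. compact (K n)" "\<And>n. K n \<subseteq> K (Suc n)"
    and dense: "closure (\<Union>n. K n) = UNIV" and p: "1 \<le> p"
  shows "\<exists>\<F> A (M :: ('g \<Rightarrow>\<^sub>C 'e::real_normed_vector) \<Rightarrow> real). averaged_norm \<F> A p M \<and>
    (\<forall>g F. left_uniformly_continuous d F \<longrightarrow> M (translate g F) = M F)"
proof -
  define good where "good n A \<longleftrightarrow> finite A \<and> A \<noteq> {} \<and> (\<forall>k\<in>K n. \<forall>f e.
      (\<forall>x y. mdist d x y < 1 / real (Suc n) \<longrightarrow> f x \<le> f y + e) \<longrightarrow>
        (\<Sum>a\<in>A. f (a + k)) \<le> (\<Sum>a\<in>A. f a) + real (card A) * e)" for n A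
  have "\<exists>A. good n A" for n
  proof (rule compact_subgroup_almost_invariant_finite_set[OF d K(1)[of n] K(2)[of n]])
    show "0 < 1 / real (Suc n)" by simp
    fix A assume A: "finite A" "A \<noteq> {}" and inv: "\<And>k f e. k \<in> K n \<Longrightarrow>
      (\<And>x y. mdist d x y < 1 / real (Suc n) \<Longrightarrow> f x \<le> f y + e) \<Longrightarrow>
        (\<Sum>a\<in>A. f (a + k)) \<le> (\<Sum>a\<in>A. f a) + real (card A) * e"
    show "\<exists>A. good n A"
      unfolding good_def by (intro exI[of _ A] conjI ballI allI impI A inv) auto
  qed
  then obtain A where good: "\<And>n. good n (A n)" by metis
  then have A: "finite (A n)" "A n \<noteq> {}" for n by (auto simp: good_def)
  have inv: "(\<Sum>a\<in>A n. f (a + k)) \<le> (\<Sum>a\<in>A n. f a) + real (card (A n)) * e"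
    if "k \<in> K n" "\<forall>x y. mdist d x y < 1 / real (Suc n) \<longrightarrow> f x \<le> f y + e" for n k f e
    using good[of n] that unfolding good_def by blast
  have "avg (A n) (\<lambda>a. norm (apply_bcontfun F a) powr p) \<le> norm F powr p" for n and F :: "'g \<Rightarrow>\<^sub>C 'e"
  proof -
    have "avg (A n) (\<lambda>a. norm (apply_bcontfun F a) powr p) \<le> avg (A n) (\<lambda>a. norm F powr p)"
      using p by (intro avg_mono powr_mono2) (auto simp: norm_bounded)
    then show ?thesis by (simp add: avg_const[OF A])
  qed
  moreover have "0 \<le> avg (A n) (\<lambda>a. norm (apply_bcontfun F a) powr p)" for n and F :: "'g \<Rightarrow>\<^sub>C 'e"
    by (simp add: avg_nonneg)
  ultimately obtain \<F> and M :: "('g \<Rightarrow>\<^sub>C 'e) \<Rightarrow> real" where \<F>: "\<F> \<noteq> bot" "\<F> \<le> sequentially"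
    and lim: "\<And>F. ((\<lambda>n. avg (A n) (\<lambda>a. norm (apply_bcontfun F a) powr p)) \<longlongrightarrow> M F) \<F>"
    using cluster_filter_exists[of "\<lambda>n F. avg (A n) (\<lambda>a. norm (apply_bcontfun F a) powr p)" "\<lambda>F. norm F powr p"]
    by blast
  interpret averaged_norm \<F> A p M
    by standard (use \<F> A lim p in auto)
  have K_le: "M (translate k F) \<le> M F" if F: "left_uniformly_continuous d F" and k: "k \<in> K m" for F k m
  proof (rule field_le_epsilon)
    fix e :: real assume e: "0 < e"
    obtain \<delta> where \<delta>: "0 < \<delta>" "\<forall>x y. mdist d x y < \<delta> \<longrightarrow>
        norm (apply_bcontfun F x) powr p \<le> norm (apply_bcontfun F y) powr p + e"
      using powr_norm_uniformly_continuous[OF F _ e, of p] p by auto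
    obtain n0 where n0: "1 / real (Suc n0) < \<delta>" using \<delta>(1) nat_approx_posE by blast
    \<comment> \<open>From \<open>m\<close> on the group \<open>K n\<close> contains
      \<open>k\<close>, and from \<open>n0\<close> on the scale of the net is finer than
      \<delta>.\<close>
    have avg_le: "avg (A n) (\<lambda>a. norm (apply_bcontfun (translate k F) a) powr p)
        \<le> avg (A n) (\<lambda>a. norm (apply_bcontfun F a) powr p) + e" if n: "n \<ge> max m n0" for n
    proof -
      have kn: "k \<in> K n" using k lift_Suc_mono_le[of K m n] K(3) n by auto
      have "1 / real (Suc n) \<le> 1 / real (Suc n0)" using n by (simp add: frac_le)
      then have "\<forall>x y. mdist d x y < 1 / real (Suc n) \<longrightarrow>
          norm (apply_bcontfun F x) powr p \<le> norm (apply_bcontfun F y) powr p + e"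
        using \<delta>(2) n0 by auto
      with kn have "(\<Sum>a\<in>A n. norm (apply_bcontfun F (a + k)) powr p)
          \<le> (\<Sum>a\<in>A n. norm (apply_bcontfun F a) powr p) + real (card (A n)) * e"
        by (rule inv)
      then have "(\<Sum>a\<in>A n. norm (apply_bcontfun F (a + k)) powr p) / real (card (A n))
          \<le> ((\<Sum>a\<in>A n. norm (apply_bcontfun F a) powr p) + real (card (A n)) * e) / real (card (A n))"
        by (rule divide_right_mono) simp
      then show ?thesis using A by (simp add: avg_def add_divide_distrib)
    qed
    show "M (translate k F) \<le> M F + e"
    proof (rule tendsto_le[OF nontrivial _ lim])
      show "((\<lambda>n. avg (A n) (\<lambda>a. norm (apply_bcontfun F a) powr p) + e) \<longlongrightarrow> M F + e) \<F>"
        by (intro tendsto_add lim tendsto_const)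
      have "eventually (\<lambda>n. avg (A n) (\<lambda>a. norm (apply_bcontfun (translate k F) a) powr p)
          \<le> avg (A n) (\<lambda>a. norm (apply_bcontfun F a) powr p) + e) sequentially"
        using avg_le by (rule eventually_sequentiallyI)
      then show "eventually (\<lambda>n. avg (A n) (\<lambda>a. norm (apply_bcontfun (translate k F) a) powr p)
          \<le> avg (A n) (\<lambda>a. norm (apply_bcontfun F a) powr p) + e) \<F>"
        by (rule filter_leD[OF \<F>(2)])
    qed
  qed
  \<comment> \<open>Approximating \<open>g\<close> by an element of some \<open>K m\<close> uses the
    triangle inequality, so the estimate is made for the seminorm and not for its p-th
    power.\<close>
  have N_le': "N (translate g F) \<le> N F" if F: "left_uniformly_continuous d F" for F g
  proof (rule field_le_epsilon)
    fix e :: real assume e: "0 < e"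
    obtain \<delta> where \<delta>: "0 < \<delta>"
      "\<forall>x y. mdist d x y < \<delta> \<longrightarrow> norm (apply_bcontfun F x - apply_bcontfun F y) \<le> e"
      using F e unfolding left_uniformly_continuous_def by blast
    have "mdist d g g = 0" using d mdist_zero[of g d g] by (simp add: compatible_left_invariant_metric_def)
    then have "g \<in> {h. mdist d g h < \<delta>}" using \<delta>(1) by simp
    moreover have "g \<in> closure (\<Union>n. K n)" using dense by simp
    ultimately obtain h m where h: "h \<in> K m" "mdist d g h < \<delta>"
      using compatible_metric_open_ball[OF d, of g \<delta>] unfolding closure_iff_nhds_not_empty by blast
    have "N (translate g F) = N ((translate g F - translate h F) + translate h F)" by simp
    also have "\<dots> \<le> N (translate g F - translate h F) + N (translate h F)" by (rule N_triangle)
    also have "\<dots> \<le> e + N F"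
    proof (rule add_mono)
      have "norm (translate g F - translate h F) \<le> e"
        by (rule translate_diff_bound[OF d _ _ h(2)]) (use \<delta>(2) e in auto)
      then show "N (translate g F - translate h F) \<le> e" using N_le_norm order_trans by blast
      show "N (translate h F) \<le> N F"
        unfolding N_def using p M_nonneg K_le[OF F h(1)] by (intro powr_mono2) auto
    qed
    finally show "N (translate g F) \<le> N F + e" by simp
  qed
  have "M (translate g F) = M F" if F: "left_uniformly_continuous d F" for g F
  proof -
    \<comment> \<open>The reverse inequality is the same estimate for the translated function and
      the inverse of \<open>g\<close>; translation preserves left uniform continuity.\<close>
    have "N F \<le> N (translate g F)"
      using N_le'[OF left_uniformly_continuous_translate[OF d F, of g], of "- g"]
      by (simp add: translate_zero flip: translate_plus)
    with N_le'[OF F, of g] have "N (translate g F) = N F" by simp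
    then show ?thesis using N_powr_p by metis
  qed
  then show ?thesis using averaged_norm_axioms by blast
qed

section \<open>The affine action\<close>

lemma coarse_embedding_upper:
  assumes "coarse_embedding d euclidean_metric \<phi>" "mspace d = UNIV" "0 \<le> t"
  shows "\<exists>B. \<forall>x y. mdist d x y \<le> t \<longrightarrow> dist (\<phi> x) (\<phi> y) \<le> B"
proof -
  have "kappa2 d euclidean_metric \<phi> t < \<infinity>"
    using assms by (simp add: coarse_embedding_def)
  then obtain B :: nat where B: "kappa2 d euclidean_metric \<phi> t < ereal (real B)"
    using less_PInf_Ex_of_nat by auto
  have "dist (\<phi> x) (\<phi> y) \<le> real B" if "mdist d x y \<le> t" for x y
  proof -
    have "ereal (dist (\<phi> x) (\<phi> y)) \<le> kappa2 d euclidean_metric \<phi> t"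
      unfolding kappa2_def by (rule Sup_upper) (use that assms(2) in auto)
    with B have "ereal (dist (\<phi> x) (\<phi> y)) < ereal (real B)" by (rule order_le_less_trans[rotated])
    then show ?thesis by simp
  qed
  then show ?thesis by blast
qed

lemma coarse_embedding_lower:
  assumes "coarse_embedding d euclidean_metric \<phi>" "mspace d = UNIV"
  shows "\<exists>t. \<forall>x y. t \<le> mdist d x y \<longrightarrow> R \<le> dist (\<phi> x) (\<phi> y)"
proof -
  have "eventually (\<lambda>t. ereal R < kappa1 d euclidean_metric \<phi> t) at_top"
    using assms(1) by (simp add: coarse_embedding_def tendsto_PInfty)
  then obtain t where t: "ereal R < kappa1 d euclidean_metric \<phi> t"
    by (auto simp: eventually_at_top_linorder)
  have "R \<le> dist (\<phi> x) (\<phi> y)" if "t \<le> mdist d x y" for x y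
  proof -
    have "kappa1 d euclidean_metric \<phi> t \<le> ereal (dist (\<phi> x) (\<phi> y))"
      unfolding kappa1_def by (rule Inf_lower) (use that assms(2) in auto)
    with t have "ereal R < ereal (dist (\<phi> x) (\<phi> y))" by (rule order_less_le_trans)
    then show ?thesis by simp
  qed
  then show ?thesis by blast
qed

text \<open>Each \<open>b g\<close> is bounded by the upper modulus at \<open>mdist d g 0\<close>,
  as \<open>x + g\<close> and \<open>x\<close> stay at that distance. For the same reason
  \<open>b\<close> is continuous into the supremum norm, which later transports separability from
  the group to the span of the cocycle.\<close>

lemma difference_cocycle:
  fixes d :: "'g::topological_group_add metric" and \<phi> :: "'g \<Rightarrow> 'e::real_normed_vector"
  assumes d: "compatible_left_invariant_metric d"
    and uc: "uniformly_continuous_map d euclidean_metric \<phi>"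
    and bdd: "\<And>t. 0 \<le> t \<Longrightarrow> \<exists>B. \<forall>x y. mdist d x y \<le> t \<longrightarrow> dist (\<phi> x) (\<phi> y) \<le> B"
  obtains b :: "'g \<Rightarrow> ('g \<Rightarrow>\<^sub>C 'e)" where
    "\<And>g x. apply_bcontfun (b g) x = \<phi> (x + g) - \<phi> x"
    "\<And>g. left_uniformly_continuous d (b g)"
    "\<And>g f. b (g + f) = translate g (b f) + b g"
    "continuous_on UNIV b"
proof -
  have sp: "mspace d = UNIV" and top: "mtopology_of d = euclidean"
    using d unfolding compatible_left_invariant_metric_def by blast+
  have inv: "mdist d (x + g) (x + h) = mdist d g h" for x g h
    using d unfolding compatible_left_invariant_metric_def by blast
  have uc': "\<exists>\<delta>>0. \<forall>x y. mdist d x y < \<delta> \<longrightarrow> dist (\<phi> x) (\<phi> y) < e" if "0 < e" for e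
    using uc that unfolding uniformly_continuous_map_def sp mspace_euclidean_metric mdist_euclidean_metric
    by blast
  have "continuous_map (mtopology_of d) (mtopology_of euclidean_metric) \<phi>"
    by (rule uniformly_continuous_imp_continuous_map[OF uc])
  then have cont: "continuous_on UNIV \<phi>" by (simp add: top)
  define b :: "'g \<Rightarrow> ('g \<Rightarrow>\<^sub>C 'e)" where "b g = Bcontfun (\<lambda>x. \<phi> (x + g) - \<phi> x)" for g
  have b: "apply_bcontfun (b g) x = \<phi> (x + g) - \<phi> x" for g x
  proof -
    obtain B where B: "\<forall>x y. mdist d x y \<le> mdist d g 0 \<longrightarrow> dist (\<phi> x) (\<phi> y) \<le> B"
      using bdd[of "mdist d g 0"] by auto
    have "norm (\<phi> (x + g) - \<phi> x) \<le> B" for x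
      using B inv[of x g 0] by (simp add: dist_norm)
    then have "bounded (range (\<lambda>x. \<phi> (x + g) - \<phi> x))"
      by (auto simp: bounded_iff)
    moreover have "continuous_on UNIV (\<lambda>x. x + g)"
      unfolding continuous_on_def by (intro ballI tendsto_intros)
    then have "continuous_on UNIV (\<lambda>x. \<phi> (x + g) - \<phi> x)"
      by (intro continuous_on_diff cont continuous_on_compose2[OF cont]) auto
    ultimately show ?thesis by (simp add: b_def Bcontfun_inverse bcontfun_def)
  qed
  moreover have "left_uniformly_continuous d (b g)" for g
    unfolding left_uniformly_continuous_def
  proof (intro allI impI)
    fix e :: real assume "0 < e"
    then obtain \<delta> where \<delta>: "0 < \<delta>" "\<forall>x y. mdist d x y < \<delta> \<longrightarrow> dist (\<phi> x) (\<phi> y) < e / 2"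
      using uc'[of "e / 2"] by auto
    obtain \<delta>' where \<delta>': "0 < \<delta>'" "\<forall>x y. mdist d x y < \<delta>' \<longrightarrow> mdist d (x + g) (y + g) < \<delta>"
      using right_translation_uniformly_continuous[OF d \<delta>(1)] by blast
    have "norm (apply_bcontfun (b g) x - apply_bcontfun (b g) y) \<le> e" if "mdist d x y < min \<delta> \<delta>'" for x y
    proof -
      have "norm (apply_bcontfun (b g) x - apply_bcontfun (b g) y)
          \<le> dist (\<phi> (x + g)) (\<phi> (y + g)) + dist (\<phi> x) (\<phi> y)"
        using norm_triangle_ineq4[of "\<phi> (x + g) - \<phi> (y + g)" "\<phi> x - \<phi> y"]
        by (simp add: b dist_norm algebra_simps)
      also have "\<dots> \<le> e / 2 + e / 2"
        using \<delta>(2) \<delta>'(2) that by (intro add_mono less_imp_le) auto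
      finally show ?thesis by simp
    qed
    then show "\<exists>\<delta>>0. \<forall>x y. mdist d x y < \<delta> \<longrightarrow> norm (apply_bcontfun (b g) x - apply_bcontfun (b g) y) \<le> e"
      using \<delta>(1) \<delta>'(1) by (intro exI[of _ "min \<delta> \<delta>'"]) simp
  qed
  moreover have "b (g + f) = translate g (b f) + b g" for g f
    by (rule bcontfun_eqI) (simp add: b add.assoc)
  moreover have "continuous_on UNIV b"
    unfolding continuous_on_def
  proof (intro ballI tendstoI)
    fix g and e :: real assume "0 < e"
    then obtain \<delta> where \<delta>: "0 < \<delta>" "\<forall>x y. mdist d x y < \<delta> \<longrightarrow> dist (\<phi> x) (\<phi> y) < e / 2"
      using uc'[of "e / 2"] by auto
    have "dist (b h) (b g) < e" if "mdist d g h < \<delta>" for h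
    proof -
      have "dist (b g) (b h) \<le> e / 2"
      proof (rule dist_bound)
        fix x
        have "dist (\<phi> (x + g)) (\<phi> (x + h)) < e / 2" using \<delta>(2) that inv[of x g h] by simp
        then show "dist (apply_bcontfun (b g) x) (apply_bcontfun (b h) x) \<le> e / 2"
          by (simp add: b dist_norm)
      qed
      then show ?thesis using \<open>0 < e\<close> by (simp add: dist_commute)
    qed
    moreover have "mdist d g g = 0" using sp mdist_zero[of g d g] by simp
    then have "eventually (\<lambda>h. h \<in> {h. mdist d g h < \<delta>}) (nhds g)"
      using \<delta>(1) by (intro eventually_nhds_in_open compatible_metric_open_ball[OF d]) simp
    ultimately have "eventually (\<lambda>h. dist (b h) (b g) < e) (nhds g)"
      by (auto elim: eventually_mono)
    then show "eventually (\<lambda>h. dist (b h) (b g) < e) (at g within UNIV)"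
      by (rule filter_leD[OF at_within_le_nhds])
  qed
  ultimately show thesis by (rule that)
qed

theorem theorem55:
  fixes d :: "'g::topological_group_add metric"
    and \<phi> :: "'g \<Rightarrow> 'e::banach"
    and p :: real and q :: ereal
  assumes "separable_space (euclidean :: 'g topology)"
    and "metrizable_space (euclidean :: 'g topology)"
    and "approximately_compact TYPE('g)"
    and "local_property_OB TYPE('g)"
    and "metrically_proper_metric d"
    and "uniformly_continuous_map d euclidean_metric \<phi>"
    and "coarse_embedding d euclidean_metric \<phi>"
    and "1 \<le> p" and "p \<le> 2" and "2 \<le> q"
    and "has_type (UNIV :: 'e set) p"
    and "has_cotype (UNIV :: 'e set) q"
  shows "\<exists>(V :: linfty set) (\<alpha> :: 'g \<Rightarrow> linfty \<Rightarrow> linfty).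
           subspace V \<and> closed V \<and> has_type V p \<and> has_cotype V q \<and>
           affine_isometric_action_on V \<alpha> \<and> metrically_proper_action_on V \<alpha>"
proof -
  have d: "compatible_left_invariant_metric d"
    using assms(5) by (simp add: metrically_proper_metric_def)
  then have sp: "mspace d = UNIV" by (simp add: compatible_left_invariant_metric_def)
  obtain b :: "'g \<Rightarrow> ('g \<Rightarrow>\<^sub>C 'e)" where
    b: "\<And>g x. apply_bcontfun (b g) x = \<phi> (x + g) - \<phi> x"
    and b_uc: "\<And>g. left_uniformly_continuous d (b g)"
    and cocycle: "\<And>g f. b (g + f) = translate g (b f) + b g"
    and b_cont: "continuous_on UNIV b"
    using difference_cocycle[OF d assms(6) coarse_embedding_upper[OF assms(7) sp]] by blast
  obtain K :: "nat \<Rightarrow> 'g set" where K: "\<forall>n. subgroup_add (K n) \<and> compact (K n) \<and> K n \<subseteq> K (Suc n)"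
    "closure (\<Union>n. K n) = UNIV"
    using assms(3) unfolding approximately_compact_def by blast
  obtain \<F> A and M :: "('g \<Rightarrow>\<^sub>C 'e) \<Rightarrow> real" where M: "averaged_norm \<F> A p M"
    and M_inv: "\<forall>g F. left_uniformly_continuous d F \<longrightarrow> M (translate g F) = M F"
    using invariant_averaged_norm_exists[where ?'e = 'e, OF d _ _ _ K(2) assms(8)] K(1) by blast
  interpret averaged_norm \<F> A p M by (rule M)
  \<comment> \<open>The span of the cocycle is large enough to carry the action and small enough to
    be separable and to contain only left uniformly continuous functions, on which \<open>M\<close>
    is translation invariant.\<close>
  define Y where "Y = span (range b)"
  have Y: "subspace Y" by (simp add: Y_def)
  have bY: "b g \<in> Y" for g by (simp add: Y_def span_base)
  have Y_uc: "left_uniformly_continuous d y" if "y \<in> Y" for y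
    using span_minimal[OF _ subspace_left_uniformly_continuous[of d], of "range b"] b_uc that
    unfolding Y_def by blast
  have Y_translate: "translate g y \<in> Y" if "y \<in> Y" for g y
  proof -
    \<comment> \<open>By the cocycle identity a translate of \<open>b f\<close> is a difference of
      two values of \<open>b\<close>.\<close>
    have "translate g (b f) \<in> Y" for f
      using subspace_diff[OF Y bY[of "g + f"] bY[of g]] by (simp add: cocycle)
    then have "range b \<subseteq> translate g -` Y" by blast
    then have "Y \<subseteq> translate g -` Y"
      unfolding Y_def using linear_subspace_vimage[OF linear_translate Y[unfolded Y_def]]
      by (rule span_minimal)
    with that show ?thesis by blast
  qed
  obtain C :: "'g set" where C: "countable C" "closure C = UNIV"
    using assms(1) unfolding separable_space_def by auto
  then have "C \<noteq> {}" by auto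
  define c where "c = b \<circ> from_nat_into C"
  have "range c = b ` C"
    unfolding c_def image_comp[symmetric] using range_from_nat_into[OF \<open>C \<noteq> {}\<close> C(1)] by simp
  moreover have "b ` closure C \<subseteq> closure (b ` C)"
    using b_cont C(2) by (intro image_closure_subset closure_subset closed_closure) simp
  ultimately have "range b \<subseteq> closure (range c)" using C(2) by simp
  then obtain D :: "nat \<Rightarrow> ('g \<Rightarrow>\<^sub>C 'e)" where D: "Y \<subseteq> closure (range D)"
    unfolding Y_def by (rule separable_span)
  have "\<exists>j. N (y - D j) < e" if y: "y \<in> Y" and e: "0 < e" for y e
  proof -
    have "y \<in> closure (range D)" using D y by (rule subsetD)
    then obtain j where "dist (D j) y < e"
      using e unfolding closure_approachable by blast
    then have "norm (y - D j) < e" by (simp add: dist_norm norm_minus_commute)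
    then show ?thesis using N_le_norm[of "y - D j"] by (intro exI[of _ j]) simp
  qed
  then obtain T :: "('g \<Rightarrow>\<^sub>C 'e) \<Rightarrow> linfty" where T: "linear T" and norm_T: "\<And>y. y \<in> Y \<Longrightarrow> norm (T y) = N y"
    using seminorm_isometric_into_linfty[of N Y D, OF N_triangle N_scale] by blast
  define V where "V = closure (T ` Y)"
  have iso: "norm (T (translate g y)) = norm (T y)" if "y \<in> Y" for g y
    using M_inv Y_uc[OF that] by (simp add: norm_T that Y_translate N_def)
  obtain \<pi> :: "'g \<Rightarrow> linfty \<Rightarrow> linfty" where \<pi>: "isometric_representation_on V \<pi>"
    and \<pi>_T: "\<And>g y. y \<in> Y \<Longrightarrow> \<pi> g (T y) = T (translate g y)"
    unfolding V_def
    using isometric_representation_on_closure[of T Y translate,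
        OF bcontfun_Cauchy_convergent T Y linear_translate Y_translate translate_zero translate_plus iso] by blast
  have TV: "T (b g) \<in> V" for g
    using bY closure_subset[of "T ` Y"] by (auto simp: V_def)
  define \<alpha> where "\<alpha> g \<xi> = \<pi> g \<xi> + T (b g)" for g \<xi>
  have "subspace V"
    unfolding V_def by (intro subspace_closure linear_subspace_image T Y)
  moreover have "closed V" by (simp add: V_def)
  moreover have "has_type V p"
    unfolding V_def using assms(8)
    by (intro has_type_closure has_type_isometric_image[OF _ T Y norm_T N_type[OF assms(11)]]) auto
  moreover have "has_cotype V q"
  proof (cases "q = \<infinity>")
    case False
    then obtain r where r: "q = ereal r" "has_finite_cotype (UNIV :: 'e set) r"
      using assms(12) by (auto simp: has_cotype_def)
    then have "2 \<le> r" using assms(10) by simp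
    then have "has_finite_cotype V r"
      unfolding V_def using assms(9)
      by (intro has_finite_cotype_closure
          has_finite_cotype_isometric_image[OF _ T Y norm_T N_cotype[OF r(2)]]) auto
    with r(1) show ?thesis by (simp add: has_cotype_def)
  qed (simp add: has_cotype_def)
  moreover have "affine_isometric_action_on V \<alpha>"
    unfolding affine_isometric_action_on_def
  proof (intro exI[of _ \<pi>] exI[of _ "\<lambda>g. T (b g)"] conjI allI ballI \<pi> TV)
    show "T (b (g + f)) = \<pi> g (T (b f)) + T (b g)" for g f
      by (simp add: cocycle linear_add[OF T] \<pi>_T bY)
  qed (simp add: \<alpha>_def)
  moreover have "metrically_proper_action_on V \<alpha>"
    unfolding metrically_proper_action_on_def
  proof (intro ballI allI impI)
    fix \<xi> and g :: "nat \<Rightarrow> 'g" assume \<xi>: "\<xi> \<in> V" and g: "tends_to_infinity g"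
    have dg: "filterlim (\<lambda>n. mdist d (g n) 0) at_top sequentially"
      using assms(5) g by (simp add: metrically_proper_metric_def)
    show "filterlim (\<lambda>n. norm (\<alpha> (g n) \<xi> - \<xi>)) at_top sequentially"
      unfolding filterlim_at_top
    proof
      fix R :: real
      \<comment> \<open>Replacing \<open>\<xi>\<close> by the origin costs at most
        \<open>2 * norm \<xi>\<close>, because the linear part is isometric. The maximum with 0
        supplies the nonnegative bound that \<open>N_ge\<close> asks for.\<close>
      define S where "S = max 0 (R + 2 * norm \<xi>)"
      obtain t where t: "\<forall>x y. t \<le> mdist d x y \<longrightarrow> S \<le> dist (\<phi> x) (\<phi> y)"
        using coarse_embedding_lower[OF assms(7) sp] by blast
      have "R \<le> norm (\<alpha> h \<xi> - \<xi>)" if h: "t \<le> mdist d h 0" for h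
      proof -
        have "mdist d (x + h) (x + 0) = mdist d h 0" for x
          using d unfolding compatible_left_invariant_metric_def by blast
        then have "S \<le> norm (apply_bcontfun (b h) x)" for x
          using t h by (simp add: b flip: dist_norm)
        then have "S \<le> norm (T (b h))"
          unfolding norm_T[OF bY] by (rule N_ge) (simp add: S_def)
        moreover have "norm (\<pi> h \<xi>) = norm \<xi>"
          using \<pi> \<xi> by (simp add: isometric_representation_on_def invertible_linear_isometry_on_def)
        moreover have "norm (T (b h)) \<le> norm (\<alpha> h \<xi> - \<xi>) + norm (\<xi> - \<pi> h \<xi>)"
          using norm_triangle_ineq[of "\<alpha> h \<xi> - \<xi>" "\<xi> - \<pi> h \<xi>"] by (simp add: \<alpha>_def)
        moreover have "norm (\<xi> - \<pi> h \<xi>) \<le> norm \<xi> + norm (\<pi> h \<xi>)" by (rule norm_triangle_ineq4)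
        ultimately show ?thesis by (simp add: S_def)
      qed
      moreover have "eventually (\<lambda>n. t \<le> mdist d (g n) 0) sequentially"
        using dg unfolding filterlim_at_top by blast
      ultimately show "eventually (\<lambda>n. R \<le> norm (\<alpha> (g n) \<xi> - \<xi>)) sequentially"
        by (auto elim: eventually_mono)
    qed
  qed
  ultimately show ?thesis by blast
qed

end
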